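(* Let $I=[0,1]$ and let $S\subset\mathbb{R}^3$ be the set $$S:=I^3+\Big\{(0,0,0),(1,0,\tfrac13),(2,0,\tfrac23),(2,1,\tfrac33),(1,1,\tfrac43),(0,1,\tfrac53),(0,0,\tfrac63),(1,0,\tfrac73),(2,0,\tfrac83),(2,1,\tfrac93),(1,1,\tfrac{10}3),(0,1,\tfrac{11}3)\Big\}.$$ Then: (i) $S$ is connected. (ii) $S$ has spectrum $\frac13\mathbb{Z}\times\frac12\mathbb{Z}\times(\mathbb{Z}+\{0,\frac14\})$. (iii) $S$ tiles $\mathbb{R}^3$ by $3\mathbb{Z}\times 2\mathbb{Z}\times(4\mathbb{Z}+\{0,1\})$. (iv) $S$ does not tile $\mathbb{R}^3$ by any lattice.
   Context: A measurable set $\Omega\subset\mathbb{R}^d$ of positive finite Lebesgue measure has spectrum $\Lambda\subset\mathbb{R}^d$ if the family of functions $e_\lambda(x)=e^{2\pi i\lambda\cdot x}$, $\lambda\in\Lambda$, is an orthogonal basis of $L^2(\Omega)$ (with Lebesgue measure). $\Omega$ tiles $\mathbb{R}^d$ by a set $\mathcal{T}\subset\mathbb{R}^d$ if $\mathbb{R}^d\setminus\bigcup_{t\in\mathcal{T}}(\Omega+t)$ has Lebesgue measure zero and $(\Omega+t)\cap(\Omega+t')$ has Lebesgue measure zero for all $t\neq t'$ in $\mathcal{T}$. A lattice in $\mathbb{R}^d$ is a discrete subgroup of rank $d$. *)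

theory Defs
  imports "HOL-Analysis.Analysis"
begin

section \<open>Orthogonal bases of \<open>L\<^sup>2\<close> and spectra\<close>

text \<open>Elements of \<open>L\<^sup>2(M)\<close> are represented by functions; functions that agree almost everywhere
  represent the same element.\<close>

definition square_integrable :: "'a measure \<Rightarrow> ('a \<Rightarrow> complex) \<Rightarrow> bool" where
  "square_integrable M f \<longleftrightarrow>
     f \<in> borel_measurable M \<and> integrable M (\<lambda>x. (cmod (f x))\<^sup>2)"

definition L2_inner :: "'a measure \<Rightarrow> ('a \<Rightarrow> complex) \<Rightarrow> ('a \<Rightarrow> complex) \<Rightarrow> complex" where
  "L2_inner M f g = (LINT x|M. f x * cnj (g x))"

definition L2_seminorm :: "'a measure \<Rightarrow> ('a \<Rightarrow> complex) \<Rightarrow> real" where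
  "L2_seminorm M f = sqrt (LINT x|M. (cmod (f x))\<^sup>2)"

text \<open>An orthogonal basis: nonzero, pairwise orthogonal elements with dense linear span.\<close>

definition orthogonal_basis_L2 :: "'a measure \<Rightarrow> 'i set \<Rightarrow> ('i \<Rightarrow> 'a \<Rightarrow> complex) \<Rightarrow> bool" where
  "orthogonal_basis_L2 M I e \<longleftrightarrow>
     (\<forall>i\<in>I. square_integrable M (e i) \<and> L2_seminorm M (e i) \<noteq> 0) \<and>
     (\<forall>i\<in>I. \<forall>j\<in>I. i \<noteq> j \<longrightarrow> L2_inner M (e i) (e j) = 0) \<and>
     (\<forall>f. square_integrable M f \<longrightarrow>
        (\<forall>\<epsilon>>0. \<exists>F c. finite F \<and> F \<subseteq> I \<and>
           L2_seminorm M (\<lambda>x. f x - (\<Sum>i\<in>F. c i * e i x)) < \<epsilon>))"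

definition exponential :: "real ^ 'n \<Rightarrow> real ^ 'n \<Rightarrow> complex" where
  "exponential l x = exp (2 * complex_of_real pi * \<i> * complex_of_real (l \<bullet> x))"

definition has_spectrum :: "(real ^ 'n) set \<Rightarrow> (real ^ 'n) set \<Rightarrow> bool" where
  "has_spectrum \<Omega> \<Lambda> \<longleftrightarrow>
     \<Omega> \<in> lmeasurable \<and> measure lebesgue \<Omega> > 0 \<and>
     orthogonal_basis_L2 (lebesgue_on \<Omega>) \<Lambda> exponential"


section \<open>Tilings and lattices\<close>

definition tiles_by :: "(real ^ 'n) set \<Rightarrow> (real ^ 'n) set \<Rightarrow> bool" where
  "tiles_by \<Omega> T \<longleftrightarrow>
     - (\<Union>t\<in>T. (+) t ` \<Omega>) \<in> null_sets lebesgue \<and>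
     (\<forall>t\<in>T. \<forall>t'\<in>T. t \<noteq> t' \<longrightarrow> ((+) t ` \<Omega>) \<inter> ((+) t' ` \<Omega>) \<in> null_sets lebesgue)"

interpretation int_module: module "\<lambda>(k::int) (v::'a::real_vector). of_int k *\<^sub>R v"
  by unfold_locales (simp_all add: scaleR_right_distrib scaleR_left_distrib)

text \<open>The rank of a subgroup as an abelian group: the maximal number of elements that are linearly
  independent over the integers.\<close>

definition has_rank :: "'a::real_vector set \<Rightarrow> nat \<Rightarrow> bool" where
  "has_rank L r \<longleftrightarrow>
     (\<exists>B\<subseteq>L. finite B \<and> int_module.independent B \<and> card B = r) \<and>
     (\<forall>B\<subseteq>L. finite B \<and> int_module.independent B \<longrightarrow> card B \<le> r)"

text \<open>\<^term>\<open>int_module.subspace L\<close> says that \<open>L\<close> is an additive subgroup.\<close>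

definition is_lattice :: "(real ^ 'n) set \<Rightarrow> bool" where
  "is_lattice L \<longleftrightarrow> int_module.subspace L \<and> discrete L \<and> has_rank L CARD('n)"


section \<open>The staircase\<close>

text \<open>\<^term>\<open>cbox 0 1 :: (real ^ 3) set\<close> is the closed unit cube.\<close>

definition S :: "(real ^ 3) set" where
  "S = {q + t | q t. q \<in> cbox 0 1 \<and> t \<in>
     {vector [0, 0, 0],    vector [1, 0, 1/3],  vector [2, 0, 2/3],
      vector [2, 1, 3/3],  vector [1, 1, 4/3],  vector [0, 1, 5/3],
      vector [0, 0, 6/3],  vector [1, 0, 7/3],  vector [2, 0, 8/3],
      vector [2, 1, 9/3],  vector [1, 1, 10/3], vector [0, 1, 11/3]}}"

end

theory Submission
  imports Defs
begin

text \<open>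
  Lattices: the staircase has a gap of the size of one cell, closed on all sides but one. In a tiling it is
  filled by exactly one cell of a single translate \<open>t + S\<close>, which leaves twelve candidates for \<open>t\<close>. If the
  translations form a group, then \<open>t\<close> and \<open>2 t\<close> are among them, and for every candidate one of \<open>t + S\<close> and
  \<open>2 t + S\<close> overlaps \<open>S\<close>.

  Orthogonality: the integral of an exponential over \<open>S\<close> is the sum of its values at the corners of the
  cells times its integral over the unit cube, and one of the two factors vanishes.

  Completeness: the bounded functions that map the closed span of the exponentials into itself form an
  algebra closed under bounded pointwise limits, so they are the bounded functions measurable with respect to
  some \<open>\<sigma>\<close>-algebra. The periods of the spectrum make \<open>x\<close>, \<open>y\<close> and \<open>z mod 1\<close> measurable for it. They
  determine a point of \<open>S\<close> up to the choice between two cells at vertical distance 2, hence they determine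
  \<open>exp (\<pi> i z)\<close>. So this function is a multiplier, then so is \<open>exp (\<pi> i z / 2)\<close>, which separates the two
  cells. Therefore the \<open>\<sigma>\<close>-algebra contains all measurable sets.
\<close>

section \<open>Multipliers of a closed subspace of \<open>L\<^sup>2\<close>\<close>

lemma cmod_add_square_le: "(cmod (a + b))\<^sup>2 \<le> 2 * (cmod a)\<^sup>2 + 2 * (cmod b)\<^sup>2"
proof -
  have "(cmod (a + b))\<^sup>2 \<le> (cmod a + cmod b)\<^sup>2"
    by (simp add: norm_triangle_ineq power_mono)
  also have "\<dots> \<le> 2 * (cmod a)\<^sup>2 + 2 * (cmod b)\<^sup>2"
    using zero_le_power2[of "cmod a - cmod b"] by (simp add: power2_eq_square algebra_simps)
  finally show ?thesis .
qed

lemma square_integrable_add: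
  assumes "square_integrable M f" "square_integrable M g"
  shows "square_integrable M (\<lambda>x. f x + g x)"
  unfolding square_integrable_def
proof
  show m: "(\<lambda>x. f x + g x) \<in> borel_measurable M"
    using assms by (auto simp: square_integrable_def)
  show "integrable M (\<lambda>x. (cmod (f x + g x))\<^sup>2)"
  proof (rule Bochner_Integration.integrable_bound)
    show "integrable M (\<lambda>x. 2 * (cmod (f x))\<^sup>2 + 2 * (cmod (g x))\<^sup>2)"
      using assms by (auto simp: square_integrable_def)
  qed (use m in measurable, auto simp: cmod_add_square_le)
qed

lemma square_integrable_bounded_mult:
  assumes "square_integrable M f" "q \<in> borel_measurable M" "\<And>x. x \<in> space M \<Longrightarrow> cmod (q x) \<le> B"
  shows "square_integrable M (\<lambda>x. q x * f x)"
  unfolding square_integrable_def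
proof
  show m: "(\<lambda>x. q x * f x) \<in> borel_measurable M"
    using assms by (auto simp: square_integrable_def)
  show "integrable M (\<lambda>x. (cmod (q x * f x))\<^sup>2)"
  proof (rule Bochner_Integration.integrable_bound)
    show "integrable M (\<lambda>x. B\<^sup>2 * (cmod (f x))\<^sup>2)"
      using assms by (auto simp: square_integrable_def)
    show "AE x in M. norm ((cmod (q x * f x))\<^sup>2) \<le> norm (B\<^sup>2 * (cmod (f x))\<^sup>2)"
      using assms(3) by (auto intro!: AE_I2 mult_right_mono power_mono simp: norm_mult power_mult_distrib)
  qed (use m in measurable)
qed

lemma square_integrable_cmult:
  "square_integrable M f \<Longrightarrow> square_integrable M (\<lambda>x. c * f x)"
  by (rule square_integrable_bounded_mult[of _ _ _ "cmod c"]) auto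

lemma square_integrable_diff:
  assumes "square_integrable M f" "square_integrable M g"
  shows "square_integrable M (\<lambda>x. f x - g x)"
  using square_integrable_add[OF assms(1) square_integrable_cmult[OF assms(2), of "-1"]] by simp

lemma square_integrable_cong_AE:
  assumes "square_integrable M f" "g \<in> borel_measurable M" "AE x in M. f x = g x"
  shows "square_integrable M g"
proof -
  have f: "f \<in> borel_measurable M" "integrable M (\<lambda>x. (cmod (f x))\<^sup>2)"
    using assms by (auto simp: square_integrable_def)
  have "integrable M (\<lambda>x. (cmod (g x))\<^sup>2)"
    by (rule integrable_cong_AE_imp[OF f(2)]) (use assms(2,3) in auto)
  then show ?thesis using assms(2) by (simp add: square_integrable_def)
qed

text \<open>A triangle inequality for squared distances, at the price of a factor 2. It replaces the
  Minkowski inequality, and it is why the approximations below are made up to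
  \<open>\<epsilon> / 4\<close>.\<close>

lemma LINT_diff_square_le:
  assumes "square_integrable M f" "square_integrable M g" "square_integrable M h"
  shows "(LINT x|M. (cmod (f x - h x))\<^sup>2)
    \<le> 2 * (LINT x|M. (cmod (f x - g x))\<^sup>2) + 2 * (LINT x|M. (cmod (g x - h x))\<^sup>2)"
proof -
  have i: "integrable M (\<lambda>x. (cmod (f x - g x))\<^sup>2)" "integrable M (\<lambda>x. (cmod (g x - h x))\<^sup>2)"
      "integrable M (\<lambda>x. (cmod (f x - h x))\<^sup>2)"
    using assms square_integrable_diff unfolding square_integrable_def by blast+
  have "(LINT x|M. (cmod (f x - h x))\<^sup>2)
      \<le> (LINT x|M. 2 * (cmod (f x - g x))\<^sup>2 + 2 * (cmod (g x - h x))\<^sup>2)"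
    using i cmod_add_square_le[of "f x - g x" "g x - h x" for x] by (intro integral_mono) auto
  also have "\<dots> = 2 * (LINT x|M. (cmod (f x - g x))\<^sup>2) + 2 * (LINT x|M. (cmod (g x - h x))\<^sup>2)"
    using i by simp
  finally show ?thesis .
qed

section \<open>Closure of a linear space of functions\<close>

locale L2_subspace = finite_measure M for M :: "'a measure" +
  fixes E :: "('a \<Rightarrow> complex) set"
  assumes sq: "g \<in> E \<Longrightarrow> square_integrable M g"
    and zero: "(\<lambda>x. 0) \<in> E"
    and add: "f \<in> E \<Longrightarrow> g \<in> E \<Longrightarrow> (\<lambda>x. f x + g x) \<in> E"
    and scale: "f \<in> E \<Longrightarrow> (\<lambda>x. c * f x) \<in> E"
begin

text \<open>Functions stand for their classes, and distances are squared, so no square root enters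
  until the very end.\<close>

definition L2_closure :: "('a \<Rightarrow> complex) set" where
  "L2_closure = {f. square_integrable M f \<and> (\<forall>\<epsilon>>0. \<exists>g\<in>E. (LINT x|M. (cmod (f x - g x))\<^sup>2) < \<epsilon>)}"

lemma L2_closure_sq: "f \<in> L2_closure \<Longrightarrow> square_integrable M f"
  by (simp add: L2_closure_def)

lemma L2_closure_approx: "f \<in> L2_closure \<Longrightarrow> \<epsilon> > 0 \<Longrightarrow> \<exists>g\<in>E. (LINT x|M. (cmod (f x - g x))\<^sup>2) < \<epsilon>"
  by (simp add: L2_closure_def)

lemma E_subset_L2_closure: "E \<subseteq> L2_closure"
  using sq by (auto simp: L2_closure_def intro!: bexI)

text \<open>Idempotence of the closure, by approximating twice. It serves below as the introduction
  rule for membership.\<close>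

lemma L2_closure_closed:
  assumes f: "square_integrable M f" and "\<And>\<epsilon>. \<epsilon> > 0 \<Longrightarrow> \<exists>g\<in>L2_closure. (LINT x|M. (cmod (f x - g x))\<^sup>2) < \<epsilon>"
  shows "f \<in> L2_closure"
proof -
  have "\<exists>h\<in>E. (LINT x|M. (cmod (f x - h x))\<^sup>2) < \<epsilon>" if \<epsilon>: "\<epsilon> > 0" for \<epsilon>
  proof -
    obtain g where g: "g \<in> L2_closure" "(LINT x|M. (cmod (f x - g x))\<^sup>2) < \<epsilon> / 4"
      using assms(2)[of "\<epsilon> / 4"] \<open>\<epsilon> > 0\<close> by (auto simp del: less_divide_eq_numeral1)
    obtain h where h: "h \<in> E" "(LINT x|M. (cmod (g x - h x))\<^sup>2) < \<epsilon> / 4"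
      using L2_closure_approx[OF g(1), of "\<epsilon> / 4"] \<epsilon> by auto
    show ?thesis
      using LINT_diff_square_le[OF f L2_closure_sq[OF g(1)] sq[OF h(1)]] g h by (intro bexI[of _ h]) auto
  qed
  then show ?thesis using f by (simp add: L2_closure_def)
qed

lemma L2_closure_add:
  assumes "f \<in> L2_closure" "g \<in> L2_closure" shows "(\<lambda>x. f x + g x) \<in> L2_closure"
proof (rule L2_closure_closed)
  show sfg: "square_integrable M (\<lambda>x. f x + g x)"
    using assms L2_closure_sq square_integrable_add by blast
  fix \<epsilon> :: real assume "\<epsilon> > 0"
  obtain f' where f': "f' \<in> E" "(LINT x|M. (cmod (f x - f' x))\<^sup>2) < \<epsilon> / 4"
    using L2_closure_approx[OF assms(1), of "\<epsilon> / 4"] \<open>\<epsilon> > 0\<close> by auto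
  obtain g' where g': "g' \<in> E" "(LINT x|M. (cmod (g x - g' x))\<^sup>2) < \<epsilon> / 4"
    using L2_closure_approx[OF assms(2), of "\<epsilon> / 4"] \<open>\<epsilon> > 0\<close> by auto
  have s: "square_integrable M (\<lambda>x. f' x + g x)"
    using assms f' L2_closure_sq sq square_integrable_add by blast
  have "(LINT x|M. (cmod ((f x + g x) - (f' x + g' x)))\<^sup>2)
     \<le> 2 * (LINT x|M. (cmod ((f x + g x) - (f' x + g x)))\<^sup>2)
       + 2 * (LINT x|M. (cmod ((f' x + g x) - (f' x + g' x)))\<^sup>2)"
    by (rule LINT_diff_square_le[OF sfg s sq[OF add[OF f'(1) g'(1)]]])
  also have "\<dots> < \<epsilon>" using f' g' by simp
  finally show "\<exists>h\<in>L2_closure. (LINT x|M. (cmod ((f x + g x) - h x))\<^sup>2) < \<epsilon>"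
    using E_subset_L2_closure add[OF f'(1) g'(1)] by (intro bexI[of _ "\<lambda>x. f' x + g' x"]) auto
qed

text \<open>Multiplication by a bounded function is a bounded operator on L2, so it maps the closure
  into itself as soon as it maps the generating space there.\<close>

lemma L2_closure_bounded_multI:
  assumes q: "q \<in> borel_measurable M" "\<And>x. x \<in> space M \<Longrightarrow> cmod (q x) \<le> B"
    and E: "\<And>g. g \<in> E \<Longrightarrow> (\<lambda>x. q x * g x) \<in> L2_closure"
    and f: "f \<in> L2_closure"
  shows "(\<lambda>x. q x * f x) \<in> L2_closure"
proof (rule L2_closure_closed)
  show "square_integrable M (\<lambda>x. q x * f x)"
    using square_integrable_bounded_mult[OF L2_closure_sq[OF f] q] .
  fix \<epsilon> :: real assume "\<epsilon> > 0"
  \<comment> \<open>The operator multiplies squared distances by at most \<open>B\<^sup>2\<close>;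
    the added 1 keeps the divisor positive.\<close>
  define \<delta> where "\<delta> = \<epsilon> / (B\<^sup>2 + 1)"
  have "B\<^sup>2 + 1 > 0" by (simp add: add_nonneg_pos)
  then have \<delta>: "\<delta> > 0" "(B\<^sup>2 + 1) * \<delta> = \<epsilon>" using \<open>\<epsilon> > 0\<close> by (auto simp: \<delta>_def)
  obtain g where g: "g \<in> E" "(LINT x|M. (cmod (f x - g x))\<^sup>2) < \<delta>"
    using L2_closure_approx[OF f \<delta>(1)] by auto
  have d: "square_integrable M (\<lambda>x. f x - g x)"
    using square_integrable_diff[OF L2_closure_sq[OF f] sq[OF g(1)]] .
  have d': "square_integrable M (\<lambda>x. q x * (f x - g x))"
    using square_integrable_bounded_mult[OF d q] .
  have "(LINT x|M. (cmod (q x * f x - q x * g x))\<^sup>2) \<le> (LINT x|M. B\<^sup>2 * (cmod (f x - g x))\<^sup>2)"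
  proof (rule integral_mono)
    show "integrable M (\<lambda>x. (cmod (q x * f x - q x * g x))\<^sup>2)"
      using d' by (simp add: square_integrable_def right_diff_distrib)
    show "integrable M (\<lambda>x. B\<^sup>2 * (cmod (f x - g x))\<^sup>2)"
      using d by (simp add: square_integrable_def)
    show "(cmod (q x * f x - q x * g x))\<^sup>2 \<le> B\<^sup>2 * (cmod (f x - g x))\<^sup>2" if "x \<in> space M" for x
      using q(2)[OF that]
      by (auto intro!: mult_right_mono power_mono simp: norm_mult power_mult_distrib
          simp flip: right_diff_distrib)
  qed
  also have "\<dots> = B\<^sup>2 * (LINT x|M. (cmod (f x - g x))\<^sup>2)"
    by simp
  also have "\<dots> \<le> B\<^sup>2 * \<delta>"
    using g by (intro mult_left_mono) auto
  also have "\<dots> < \<epsilon>" using \<delta> by (simp add: algebra_simps)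
  finally show "\<exists>h\<in>L2_closure. (LINT x|M. (cmod (q x * f x - h x))\<^sup>2) < \<epsilon>"
    using E[OF g(1)] by (intro bexI[of _ "\<lambda>x. q x * g x"]) auto
qed

lemma L2_closure_scale: "f \<in> L2_closure \<Longrightarrow> (\<lambda>x. c * f x) \<in> L2_closure"
  by (rule L2_closure_bounded_multI[where B = "cmod c"]) (use scale E_subset_L2_closure in auto)

lemma L2_closure_cong_AE:
  assumes "f \<in> L2_closure" "g \<in> borel_measurable M" "AE x in M. f x = g x"
  shows "g \<in> L2_closure"
proof (rule L2_closure_closed)
  show g: "square_integrable M g"
    using square_integrable_cong_AE[OF L2_closure_sq[OF assms(1)] assms(2,3)] .
  have "(LINT x|M. (cmod (g x - f x))\<^sup>2) = (LINT x|M. 0)"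
    by (rule integral_cong_AE)
      (use assms L2_closure_sq[OF assms(1)] in \<open>auto simp: square_integrable_def\<close>)
  then show "\<exists>h\<in>L2_closure. (LINT x|M. (cmod (g x - h x))\<^sup>2) < \<epsilon>" if "\<epsilon> > 0" for \<epsilon>
    using assms(1) that by (intro bexI[of _ f]) auto
qed

lemma L2_closure_dominated:
  assumes F: "\<And>n. F n \<in> L2_closure" and h: "square_integrable M h" and f: "f \<in> borel_measurable M"
    and lim: "\<And>x. x \<in> space M \<Longrightarrow> (\<lambda>n. F n x) \<longlonglongrightarrow> f x"
    and dom: "\<And>n x. x \<in> space M \<Longrightarrow> cmod (F n x) \<le> cmod (h x)"
  shows "f \<in> L2_closure"
proof (rule L2_closure_closed)
  have le: "cmod (f x) \<le> cmod (h x)" if "x \<in> space M" for x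
    by (rule LIMSEQ_le_const2[OF tendsto_norm[OF lim[OF that]]]) (use dom[OF that] in auto)
  have h': "h \<in> borel_measurable M" "integrable M (\<lambda>x. (cmod (h x))\<^sup>2)"
    using h by (auto simp: square_integrable_def)
  have F': "F n \<in> borel_measurable M" for n
    using L2_closure_sq[OF F] by (auto simp: square_integrable_def)
  show "square_integrable M f"
    unfolding square_integrable_def
    by (intro conjI f Bochner_Integration.integrable_bound[OF h'(2)])
      (use f le in \<open>auto intro!: AE_I2 power_mono\<close>)
  fix \<epsilon> :: real assume "\<epsilon> > 0"
  have "(\<lambda>n. LINT x|M. (cmod (f x - F n x))\<^sup>2) \<longlonglongrightarrow> (LINT x|M. 0)"
  \<comment> \<open>Both \<open>f\<close> and \<open>F n\<close> are bounded by \<open>h\<close> in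
    modulus, so their difference is at most twice that, and its square at most four times the
    square.\<close>
  proof (rule integral_dominated_convergence[where w = "\<lambda>x. 4 * (cmod (h x))\<^sup>2"])
    have "(\<lambda>n. (cmod (f x - F n x))\<^sup>2) \<longlonglongrightarrow> (cmod (f x - f x))\<^sup>2" if "x \<in> space M" for x
      by (intro tendsto_intros lim[OF that])
    then show "AE x in M. (\<lambda>n. (cmod (f x - F n x))\<^sup>2) \<longlonglongrightarrow> 0"
      by (intro AE_I2) simp
    have "(cmod (f x - F n x))\<^sup>2 \<le> 4 * (cmod (h x))\<^sup>2" if "x \<in> space M" for x n
    proof -
      have "cmod (f x - F n x) \<le> 2 * cmod (h x)"
        using norm_triangle_ineq4[of "f x" "F n x"] le[OF that] dom[OF that, of n] by linarith
      then have "(cmod (f x - F n x))\<^sup>2 \<le> (2 * cmod (h x))\<^sup>2" by (intro power_mono) auto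
      then show ?thesis by (simp add: power_mult_distrib)
    qed
    then show "AE x in M. norm ((cmod (f x - F n x))\<^sup>2) \<le> 4 * (cmod (h x))\<^sup>2" for n
      by (intro AE_I2) simp
  qed (use f F' h' in auto)
  then have "\<forall>\<^sub>F n in sequentially. (LINT x|M. (cmod (f x - F n x))\<^sup>2) < \<epsilon>"
    using \<open>\<epsilon> > 0\<close> by (intro order_tendstoD) auto
  then obtain n where "(LINT x|M. (cmod (f x - F n x))\<^sup>2) < \<epsilon>"
    by (auto simp: eventually_sequentially)
  then show "\<exists>h\<in>L2_closure. (LINT x|M. (cmod (f x - h x))\<^sup>2) < \<epsilon>"
    using F by blast
qed

section \<open>The algebra of multipliers\<close>

definition multiplier :: "('a \<Rightarrow> complex) \<Rightarrow> bool" where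
  "multiplier q \<longleftrightarrow> q \<in> borel_measurable M \<and> (\<exists>B. \<forall>x\<in>space M. cmod (q x) \<le> B) \<and>
     (\<forall>f\<in>L2_closure. (\<lambda>x. q x * f x) \<in> L2_closure)"

lemma multiplierD: "multiplier q \<Longrightarrow> f \<in> L2_closure \<Longrightarrow> (\<lambda>x. q x * f x) \<in> L2_closure"
  by (simp add: multiplier_def)

lemma multiplierI:
  assumes "q \<in> borel_measurable M" "\<And>x. x \<in> space M \<Longrightarrow> cmod (q x) \<le> B"
    and "\<And>g. g \<in> E \<Longrightarrow> (\<lambda>x. q x * g x) \<in> L2_closure"
  shows "multiplier q"
  unfolding multiplier_def using assms L2_closure_bounded_multI[OF assms] by blast

lemma multiplier_const: "multiplier (\<lambda>x. c)"
  unfolding multiplier_def using L2_closure_scale by auto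

lemma multiplier_mult:
  assumes "multiplier p" "multiplier q" shows "multiplier (\<lambda>x. p x * q x)"
proof -
  obtain B C where "\<forall>x\<in>space M. cmod (p x) \<le> B" "\<forall>x\<in>space M. cmod (q x) \<le> C"
    using assms by (auto simp: multiplier_def)
  then have "\<forall>x\<in>space M. cmod (p x * q x) \<le> B * C"
    by (auto simp: norm_mult intro!: mult_mono' )
  moreover have "(\<lambda>x. (p x * q x) * f x) \<in> L2_closure" if "f \<in> L2_closure" for f
  proof -
    have "(\<lambda>x. p x * (q x * f x)) \<in> L2_closure"
      by (intro multiplierD[OF assms(1)] multiplierD[OF assms(2)] that)
    then show ?thesis by (simp add: mult.assoc)
  qed
  ultimately show ?thesis using assms unfolding multiplier_def by auto
qed

lemma multiplier_add:
  assumes "multiplier p" "multiplier q" shows "multiplier (\<lambda>x. p x + q x)"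
proof -
  obtain B C where "\<forall>x\<in>space M. cmod (p x) \<le> B" "\<forall>x\<in>space M. cmod (q x) \<le> C"
    using assms by (auto simp: multiplier_def)
  then have "\<forall>x\<in>space M. cmod (p x + q x) \<le> B + C"
    by (auto intro!: norm_triangle_mono)
  moreover have "(\<lambda>x. (p x + q x) * f x) \<in> L2_closure" if "f \<in> L2_closure" for f
    using L2_closure_add[of "\<lambda>x. p x * f x" "\<lambda>x. q x * f x"] that assms
    by (auto simp: multiplier_def distrib_right)
  ultimately show ?thesis using assms unfolding multiplier_def by auto
qed

lemma multiplier_sum:
  "finite I \<Longrightarrow> (\<And>i. i \<in> I \<Longrightarrow> multiplier (p i)) \<Longrightarrow> multiplier (\<lambda>x. \<Sum>i\<in>I. p i x)"
  by (induction I rule: finite_induct) (auto intro: multiplier_const multiplier_add)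

text \<open>Being a multiplier depends only on the class modulo null sets. This is what later allows
  computations off the faces of the cells.\<close>

lemma multiplier_cong_AE:
  assumes "multiplier p" "q \<in> borel_measurable M" "\<And>x. x \<in> space M \<Longrightarrow> cmod (q x) \<le> B"
    and "AE x in M. p x = q x"
  shows "multiplier q"
proof (rule multiplierI[OF assms(2,3)])
  fix g assume g: "g \<in> E"
  show "(\<lambda>x. q x * g x) \<in> L2_closure"
  proof (rule L2_closure_cong_AE)
    show "(\<lambda>x. p x * g x) \<in> L2_closure" using g E_subset_L2_closure assms(1) by (auto simp: multiplier_def)
    show "(\<lambda>x. q x * g x) \<in> borel_measurable M"
      using sq[OF g] assms(2) by (auto simp: square_integrable_def)
  qed (use assms(4) in auto)
qed

text \<open>For \<open>g\<close> in the generating space the products \<open>Q n * g\<close> are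
  dominated by a constant multiple of \<open>g\<close>, so dominated convergence keeps the limit in
  the closure.\<close>

lemma multiplier_lim:
  assumes q: "\<And>n. multiplier (Q n)" "\<And>n x. x \<in> space M \<Longrightarrow> cmod (Q n x) \<le> B"
    and lim: "\<And>x. x \<in> space M \<Longrightarrow> (\<lambda>n. Q n x) \<longlonglongrightarrow> q x"
  shows "multiplier q"
proof (rule multiplierI)
  show qm: "q \<in> borel_measurable M"
    by (rule borel_measurable_LIMSEQ_metric[OF _ lim]) (use q in \<open>auto simp: multiplier_def\<close>)
  show "cmod (q x) \<le> B" if "x \<in> space M" for x
    by (rule LIMSEQ_le_const2[OF tendsto_norm[OF lim[OF that]]]) (use q that in auto)
  fix g assume g: "g \<in> E"
  show "(\<lambda>x. q x * g x) \<in> L2_closure"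
  proof (rule L2_closure_dominated)
    show "(\<lambda>x. Q n x * g x) \<in> L2_closure" for n using q g E_subset_L2_closure by (auto simp: multiplier_def)
    show "square_integrable M (\<lambda>x. of_real B * g x)" by (rule square_integrable_cmult[OF sq[OF g]])
    show "(\<lambda>x. q x * g x) \<in> borel_measurable M"
      using sq[OF g] qm by (auto simp: square_integrable_def)
    show "(\<lambda>n. Q n x * g x) \<longlonglongrightarrow> q x * g x" if "x \<in> space M" for x
      by (intro tendsto_intros lim that)
    show "cmod (Q n x * g x) \<le> cmod (of_real B * g x)" if "x \<in> space M" for x n
    proof -
      have "cmod (Q n x) \<le> \<bar>B\<bar>" using q(2)[OF that, of n] by linarith
      then show ?thesis by (auto simp: norm_mult intro!: mult_right_mono)
    qed
  qed
qed

section \<open>The sigma-algebra belonging to the multipliers\<close>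

definition multiplier_sets :: "'a set set" where
  "multiplier_sets = {A \<in> sets M. multiplier (indicator A)}"

lemma multiplier_cong:
  assumes "multiplier p" "\<And>x. x \<in> space M \<Longrightarrow> p x = q x"
  shows "multiplier q"
proof -
  obtain B where B: "\<forall>x\<in>space M. cmod (p x) \<le> B" using assms(1) by (auto simp: multiplier_def)
  have "q \<in> borel_measurable M"
    using assms measurable_cong[of M p q] by (auto simp: multiplier_def)
  then show ?thesis
    using B assms(2) by (intro multiplier_cong_AE[OF assms(1), of _ B]) auto
qed

text \<open>Complements and finite unions come from the algebra structure, through 1 - 1_A and 1_A +
  1_B - 1_A 1_B. Countable unions are bounded pointwise limits of finite ones.\<close>

lemma sigma_algebra_multiplier_sets: "sigma_algebra (space M) multiplier_sets"
proof -
  have empty: "{} \<in> multiplier_sets"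
    using multiplier_const[of 0] by (simp add: multiplier_sets_def indicator_def[abs_def])
  have compl: "space M - A \<in> multiplier_sets" if "A \<in> multiplier_sets" for A
  proof -
    have "multiplier (\<lambda>x. 1 + (-1) * indicator A x)"
      using that by (intro multiplier_add multiplier_mult multiplier_const) (auto simp: multiplier_sets_def)
    then have "multiplier (indicator (space M - A))"
      by (rule multiplier_cong) (auto simp: indicator_def)
    then show ?thesis using that by (auto simp: multiplier_sets_def)
  qed
  have union: "A \<union> B \<in> multiplier_sets" if "A \<in> multiplier_sets" "B \<in> multiplier_sets" for A B
  proof -
    have "multiplier (\<lambda>x. indicator A x + (indicator B x + (-1) * (indicator A x * indicator B x)))"
      using that by (intro multiplier_add multiplier_mult multiplier_const) (auto simp: multiplier_sets_def)
    then have "multiplier (indicator (A \<union> B))"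
      by (rule multiplier_cong) (auto simp: indicator_def)
    then show ?thesis using that by (auto simp: multiplier_sets_def)
  qed
  have "(\<Union>i. A i) \<in> multiplier_sets" if A: "range A \<subseteq> multiplier_sets" for A :: "nat \<Rightarrow> 'a set"
  proof -
    have fin: "(\<Union>i<n. A i) \<in> multiplier_sets" for n
    proof (induction n)
      case (Suc n)
      then have "A n \<union> (\<Union>i<n. A i) \<in> multiplier_sets" using A by (intro union) auto
      then show ?case by (simp add: lessThan_Suc)
    qed (simp add: empty)
    have "multiplier (indicator (\<Union>i. A i))"
    proof (rule multiplier_lim)
      show "multiplier (indicator (\<Union>i<n. A i))" for n using fin[of n] by (simp add: multiplier_sets_def)
      show "cmod (indicator (\<Union>i<n. A i) x) \<le> 1" for n x by (simp add: indicator_def)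
      show "(\<lambda>n. indicator (\<Union>i<n. A i) x :: complex) \<longlonglongrightarrow> indicator (\<Union>i. A i) x" for x
        by (rule LIMSEQ_indicator_UN)
    qed
    moreover have "(\<Union>i. A i) \<in> sets M" using A by (auto simp: multiplier_sets_def)
    ultimately show ?thesis by (simp add: multiplier_sets_def)
  qed
  moreover have "multiplier_sets \<subseteq> Pow (space M)"
    using sets.space_closed[of M] unfolding multiplier_sets_def by blast
  ultimately show ?thesis
    using empty compl unfolding sigma_algebra_iff2 by simp
qed

text \<open>The sigma-algebra in the form of a measure space, so that
  \<open>borel_measurable\<close> and \<open>simple_function\<close> apply to it.\<close>

definition multiplier_measure :: "'a measure" where "multiplier_measure = sigma (space M) multiplier_sets"

lemma space_multiplier_measure [simp]: "space multiplier_measure = space M"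
  by (simp add: multiplier_measure_def space_measure_of_conv)

lemma sets_multiplier_measure: "sets multiplier_measure = multiplier_sets"
  unfolding multiplier_measure_def by (rule sigma_algebra.sets_measure_of_eq[OF sigma_algebra_multiplier_sets])

lemma multiplier_real_polynomial:
  assumes "real_polynomial_function p" "multiplier (\<lambda>x. of_real (\<phi> x))"
  shows "multiplier (\<lambda>x. of_real (p (\<phi> x)))"
  using assms(1)
proof induction
  case (linear f)
  then obtain c where "f = (\<lambda>x. x * c)"
    using real_bounded_linear by blast
  then show ?case
    using multiplier_mult[OF assms(2) multiplier_const[of "of_real c"]] by simp
qed (auto simp: multiplier_const multiplier_mult multiplier_add)

text \<open>The indicator of a sublevel set of \<open>\<phi>\<close> is a pointwise limit of
  continuous functions of \<open>\<phi>\<close>. By the Weierstrass theorem on the bounded range of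
  \<open>\<phi>\<close> these may be replaced by polynomials in \<open>\<phi>\<close>, which are
  multipliers.\<close>

lemma multiplier_imp_measurable_multiplier_measure:
  fixes \<phi> :: "'a \<Rightarrow> real"
  assumes "multiplier (\<lambda>x. of_real (\<phi> x))"
  shows "\<phi> \<in> borel_measurable multiplier_measure"
  unfolding borel_measurable_iff_le
proof
  fix a
  obtain B where "\<forall>x\<in>space M. cmod (of_real (\<phi> x)) \<le> B" using assms by (auto simp: multiplier_def)
  then have B: "\<phi> x \<in> {-B..B}" if "x \<in> space M" for x using that by fastforce
  have m: "\<phi> \<in> borel_measurable M"
    using assms by (auto simp: multiplier_def borel_measurable_complex_iff)
  \<comment> \<open>A ramp: 1 up to \<open>a\<close>, then falling with slope \<open>-n\<close>
    until it reaches 0.\<close>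
  define c where "c = (\<lambda>n s. max 0 (min 1 (1 - real n * (s - a))))"
  have "\<exists>p. real_polynomial_function p \<and> (\<forall>s\<in>{-B..B}. \<bar>c n s - p s\<bar> < 1 / (real n + 1))" for n
    by (rule Stone_Weierstrass_real_polynomial_function[of "{-B..B}" "c n" "1 / (real n + 1)"])
      (auto simp: c_def intro!: continuous_intros)
  then obtain p where p: "\<And>n. real_polynomial_function (p n)"
      "\<And>n s. s \<in> {-B..B} \<Longrightarrow> \<bar>c n s - p n s\<bar> < 1 / (real n + 1)"
    by metis
  have c_lim: "(\<lambda>n. c n s) \<longlonglongrightarrow> indicator {..a} s" for s
  proof (cases "s \<le> a")
    case True
    then have "c n s = 1" for n
      by (auto simp: c_def min_def max_def mult_nonneg_nonpos)
    then show ?thesis using True by simp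
  next
    case False
    obtain n0 where n0: "1 / (s - a) < real n0" using reals_Archimedean2 by blast
    have "c n s = 0" if "n \<ge> n0" for n
    proof -
      have "1 / (s - a) < real n" using n0 that by linarith
      then have "1 < real n * (s - a)" using False by (simp add: pos_divide_less_eq)
      then show ?thesis by (simp add: c_def)
    qed
    then have "\<forall>\<^sub>F n in sequentially. c n s = 0" by (auto simp: eventually_sequentially)
    then show ?thesis using False by (simp add: tendsto_eventually)
  qed
  have "multiplier (indicator {x \<in> space M. \<phi> x \<le> a})"
  proof (rule multiplier_lim)
    show "multiplier (\<lambda>x. of_real (p n (\<phi> x)))" for n
      by (rule multiplier_real_polynomial[OF p(1) assms])
    \<comment> \<open>The ramp is at most 1, and the approximation error is at most 1.\<close>
    show "cmod (of_real (p n (\<phi> x))) \<le> 2" if "x \<in> space M" for n x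
    proof -
      have "\<bar>c n (\<phi> x)\<bar> \<le> 1" by (simp add: c_def)
      moreover have "1 / (real n + 1) \<le> 1" by simp
      ultimately show ?thesis using p(2)[OF B[OF that], of n] by (simp del: divide_le_eq_1_pos)
    qed
    show "(\<lambda>n. complex_of_real (p n (\<phi> x))) \<longlonglongrightarrow> indicator {x \<in> space M. \<phi> x \<le> a} x" if "x \<in> space M" for x
    proof -
      have "(\<lambda>n. c n (\<phi> x) - p n (\<phi> x)) \<longlonglongrightarrow> 0"
      proof (rule Lim_null_comparison)
        show "\<forall>\<^sub>F n in sequentially. norm (c n (\<phi> x) - p n (\<phi> x)) \<le> 1 / (real n + 1)"
          using p(2)[OF B[OF that]] by (intro always_eventually allI) (simp add: less_imp_le)
        show "(\<lambda>n. 1 / (real n + 1)) \<longlonglongrightarrow> 0"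
          using LIMSEQ_inverse_real_of_nat by (simp add: inverse_eq_divide add.commute)
      qed
      then have "(\<lambda>n. c n (\<phi> x) - (c n (\<phi> x) - p n (\<phi> x))) \<longlonglongrightarrow> indicator {..a} (\<phi> x) - 0"
        by (intro tendsto_diff c_lim)
      then have "(\<lambda>n. complex_of_real (p n (\<phi> x))) \<longlonglongrightarrow> of_real (indicator {..a} (\<phi> x))"
        by (intro tendsto_of_real) simp
      then show ?thesis using that by (auto simp: indicator_def split: if_splits)
    qed
  qed
  moreover have "{x \<in> space M. \<phi> x \<le> a} \<in> sets M" using m by measurable
  ultimately show "{w \<in> space multiplier_measure. \<phi> w \<le> a} \<in> sets multiplier_measure" by (simp add: sets_multiplier_measure multiplier_sets_def)
qed

text \<open>Simple functions are linear combinations of indicators that are multipliers, and bounded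
  limits of such combinations remain multipliers.\<close>

lemma measurable_multiplier_measure_imp_multiplier:
  assumes f: "f \<in> borel_measurable multiplier_measure" and B: "\<And>x. x \<in> space M \<Longrightarrow> cmod (f x) \<le> B"
  shows "multiplier f"
proof -
  obtain F where "\<forall>i. simple_function multiplier_measure (F i)" "\<forall>x\<in>space multiplier_measure. (\<lambda>i. F i x) \<longlonglongrightarrow> f x"
      "\<forall>i. \<forall>x\<in>space multiplier_measure. dist (F i x) 0 \<le> 2 * dist (f x) 0"
    using borel_measurable_implies_sequence_metric[OF f, of 0] by blast
  then have F: "\<And>i. simple_function multiplier_measure (F i)" "\<And>x. x \<in> space M \<Longrightarrow> (\<lambda>i. F i x) \<longlonglongrightarrow> f x"
      "\<And>i x. x \<in> space M \<Longrightarrow> cmod (F i x) \<le> 2 * cmod (f x)"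
    by auto
  have "multiplier (F i)" for i
  proof -
    have "multiplier (\<lambda>x. \<Sum>y \<in> F i ` space M. indicator (F i -` {y} \<inter> space M) x * y)"
    proof (intro multiplier_sum multiplier_mult multiplier_const)
      show "finite (F i ` space M)" using simple_functionD(1)[OF F(1)] by simp
      show "multiplier (indicator (F i -` {y} \<inter> space M))" for y
        using simple_functionD(2)[OF F(1), of i "{y}"] by (simp add: sets_multiplier_measure multiplier_sets_def)
    qed
    then show ?thesis
    proof (rule multiplier_cong)
      fix x assume "x \<in> space M"
      then have "F i x = (\<Sum>y \<in> F i ` space M. indicator (F i -` {y} \<inter> space M) x *\<^sub>R y)"
        by (intro simple_function_indicator_representation_banach[OF F(1), unfolded space_multiplier_measure])
      also have "\<dots> = (\<Sum>y \<in> F i ` space M. indicator (F i -` {y} \<inter> space M) x * y)"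
        by (intro sum.cong) (simp_all add: indicator_def)
      finally show "(\<Sum>y \<in> F i ` space M. indicator (F i -` {y} \<inter> space M) x * y) = F i x"
        by (rule sym)
    qed
  qed
  \<comment> \<open>The approximating simple functions are only known to be at most twice as large
    as \<open>f\<close>.\<close>
  moreover have "cmod (F i x) \<le> 2 * B" if "x \<in> space M" for i x
    using F(3)[OF that, of i] B[OF that] by linarith
  ultimately show ?thesis using F(2) by (rule multiplier_lim)
qed

lemma sets_multiplier_measure_subset: "sets multiplier_measure \<subseteq> sets M"
  by (auto simp: sets_multiplier_measure multiplier_sets_def)

text \<open>The sigma-algebra contains every measurable modification of its members on a null
  set.\<close>

lemma sets_multiplier_measure_AE:
  assumes "A \<in> sets multiplier_measure" "B \<in> sets M" "AE x in M. x \<in> A \<longleftrightarrow> x \<in> B"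
  shows "B \<in> sets multiplier_measure"
proof -
  have "multiplier (indicator B)"
  proof (rule multiplier_cong_AE)
    show "multiplier (indicator A)" using assms(1) by (simp add: sets_multiplier_measure multiplier_sets_def)
    show "AE x in M. indicator A x = (indicator B x :: complex)"
      using assms(3) by eventually_elim (auto simp: indicator_def)
    show "cmod (indicator B x) \<le> 1" for x by (simp add: indicator_def)
  qed (use assms(2) in auto)
  then show ?thesis using assms(2) by (simp add: sets_multiplier_measure multiplier_sets_def)
qed

lemma measurable_multiplier_measure_cong_AE:
  assumes "f \<in> borel_measurable multiplier_measure" "g \<in> borel_measurable M" "AE x in M. f x = g x"
  shows "g \<in> borel_measurable multiplier_measure"
proof (rule measurableI)
  fix A :: "'b set" assume A: "A \<in> sets borel"
  show "g -` A \<inter> space multiplier_measure \<in> sets multiplier_measure"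
  proof (rule sets_multiplier_measure_AE)
    show "f -` A \<inter> space multiplier_measure \<in> sets multiplier_measure" using assms(1) A by (rule measurable_sets)
    show "g -` A \<inter> space multiplier_measure \<in> sets M" using measurable_sets[OF assms(2) A] by simp
    show "AE x in M. (x \<in> f -` A \<inter> space multiplier_measure) = (x \<in> g -` A \<inter> space multiplier_measure)"
      using assms(3) by eventually_elim auto
  qed
qed simp

text \<open>Once all measurable sets are available, every truncation of \<open>f\<close> is a
  multiplier. Applied to the constant 1 it lies in the closure, and the truncations converge to
  \<open>f\<close> under the bound \<open>f\<close>.\<close>

lemma L2_closure_eq_if_sets_multiplier_measure:
  assumes "sets multiplier_measure = sets M" "(\<lambda>x. 1) \<in> L2_closure" "square_integrable M f"
  shows "f \<in> L2_closure"
proof (rule L2_closure_dominated[OF _ assms(3)])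
  have m: "f \<in> borel_measurable M" using assms(3) by (simp add: square_integrable_def)
  then show "f \<in> borel_measurable M" .
  define F where "F n x = f x * indicator {x \<in> space M. cmod (f x) \<le> real n} x" for n x
  have "F n \<in> borel_measurable M" for n
    unfolding F_def using m by measurable
  then have "F n \<in> borel_measurable multiplier_measure" for n
    using measurable_cong_sets[OF assms(1) refl, of "borel :: complex measure"] by simp
  then have "multiplier (F n)" for n
    by (rule measurable_multiplier_measure_imp_multiplier[where B = "real n"]) (auto simp: F_def indicator_def)
  then have "(\<lambda>x. F n x * 1) \<in> L2_closure" for n
    by (intro multiplierD assms(2))
  then show "F n \<in> L2_closure" for n by simp
  show "(\<lambda>n. F n x) \<longlonglongrightarrow> f x" if x: "x \<in> space M" for x
  proof (rule tendsto_eventually)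
    obtain n0 where "cmod (f x) \<le> real n0" using real_arch_simple by blast
    then have "F n x = f x" if "n \<ge> n0" for n using that x by (auto simp: F_def indicator_def)
    then show "\<forall>\<^sub>F n in sequentially. F n x = f x" by (auto simp: eventually_sequentially)
  qed
  show "cmod (F n x) \<le> cmod (f x)" for n x by (simp add: F_def indicator_def)
qed

lemma L2_closure_sum:
  "finite I \<Longrightarrow> (\<And>i. i \<in> I \<Longrightarrow> f i \<in> L2_closure) \<Longrightarrow> (\<lambda>x. \<Sum>i\<in>I. f i x) \<in> L2_closure"
proof (induction I rule: finite_induct)
  case empty
  then show ?case using zero E_subset_L2_closure by auto
next
  case (insert i I)
  then have "(\<lambda>x. f i x + (\<Sum>i\<in>I. f i x)) \<in> L2_closure" by (intro L2_closure_add) auto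
  then show ?case using insert by simp
qed

text \<open>With the conjugate at hand, real and imaginary part are multipliers, so the criterion
  for real functions applies to each.\<close>

lemma multiplier_cnj_imp_measurable_multiplier_measure:
  assumes "multiplier q" "multiplier (\<lambda>x. cnj (q x))"
  shows "q \<in> borel_measurable multiplier_measure"
proof -
  have "multiplier (\<lambda>x. 1/2 * (q x + cnj (q x)))"
    by (intro multiplier_mult multiplier_const multiplier_add assms)
  then have "multiplier (\<lambda>x. of_real (Re (q x)))"
    by (rule multiplier_cong) (simp add: complex_eq_iff)
  moreover have "multiplier (\<lambda>x. - \<i>/2 * (q x + (-1) * cnj (q x)))"
    by (intro multiplier_mult multiplier_const multiplier_add assms)
  then have "multiplier (\<lambda>x. of_real (Im (q x)))"
    by (rule multiplier_cong) (simp add: complex_eq_iff)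
  ultimately show ?thesis
    unfolding borel_measurable_complex_iff by (auto intro: multiplier_imp_measurable_multiplier_measure)
qed

end

section \<open>Tilings by the staircase\<close>

definition cube :: "real ^ 'n \<Rightarrow> (real ^ 'n) set" where
  "cube v = cbox v (v + 1)"

lemma mem_cube: "p \<in> cube v \<longleftrightarrow> (\<forall>i. v $ i \<le> p $ i \<and> p $ i \<le> v $ i + 1)"
  by (simp add: cube_def mem_box_cart)

lemma translate_cube: "(+) t ` cube v = cube (t + v)"
  by (simp add: cube_def add.assoc cbox_translation)

lemma cube_meets_cube:
  assumes "\<forall>i. \<bar>u $ i - v $ i\<bar> \<le> 1"
  shows "cube u \<inter> cube v \<noteq> {}"
proof -
  have "u $ i - v $ i \<le> 1 \<and> v $ i - u $ i \<le> 1" for i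
    using assms by (simp add: abs_le_iff)
  \<comment> \<open>The coordinatewise maximum of the two lower corners lies in both cubes.\<close>
  then have "(\<chi> i. max (u $ i) (v $ i)) \<in> cube u \<inter> cube v"
    by (auto simp: mem_cube max_def algebra_simps)
  then show ?thesis by blast
qed

lemma box_not_null:
  fixes a b :: "real ^ 'n"
  assumes "\<forall>i. a $ i < b $ i" "box a b \<subseteq> N"
  shows "N \<notin> null_sets lebesgue"
proof
  assume "N \<in> null_sets lebesgue"
  then have "negligible (box a b)"
    using assms(2) negligible_subset by (auto simp: negligible_iff_null_sets)
  moreover have "box a b \<noteq> {}"
    using assms(1) by (simp add: interval_ne_empty_cart)
  ultimately show False
    using open_not_negligible by blast
qed

lemma cube_overlap_not_null:
  fixes u v :: "real ^ 'n"
  assumes "\<forall>i. \<bar>u $ i - v $ i\<bar> < 1" "cube u \<inter> cube v \<subseteq> N"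
  shows "N \<notin> null_sets lebesgue"
proof (rule box_not_null, intro allI)
  fix i
  show "(\<chi> i. max (u $ i) (v $ i)) $ i < (\<chi> i. min (u $ i) (v $ i) + 1) $ i"
    using spec[OF assms(1), of i] by (auto simp: max_def min_def)
next
  show "box (\<chi> i. max (u $ i) (v $ i)) (\<chi> i. min (u $ i) (v $ i) + 1) \<subseteq> N"
  proof (rule order_trans[OF _ assms(2)], rule subsetI)
    fix p assume p: "p \<in> box (\<chi> i. max (u $ i) (v $ i)) (\<chi> i. min (u $ i) (v $ i) + 1)"
    have "u $ i < p $ i \<and> v $ i < p $ i \<and> p $ i < u $ i + 1 \<and> p $ i < v $ i + 1" for i
      using p by (auto simp: mem_box_cart less_diff_eq[symmetric] dest!: spec[of _ i])
    then show "p \<in> cube u \<inter> cube v"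
      by (auto simp: mem_cube intro: less_imp_le)
  qed
qed

text \<open>The cell \<open>(X, Y, j)\<close> lies above the square with corner \<open>(X, Y)\<close>, in the turn \<open>j\<close> of the staircase.\<close>

definition step_height :: "int \<Rightarrow> int \<Rightarrow> int" where
  "step_height X Y = (if Y = 0 then X else 5 - X)"

definition corner :: "int \<times> int \<times> int \<Rightarrow> real ^ 3" where
  "corner = (\<lambda>(X, Y, j). vector [of_int X, of_int Y, of_int (step_height X Y) / 3 + 2 * of_int j])"

text \<open>Listed in the order in which one climbs the staircase, so that consecutive cells
  touch.\<close>

definition cells :: "(int \<times> int \<times> int) list" where
  "cells = [(0,0,0), (1,0,0), (2,0,0), (2,1,0), (1,1,0), (0,1,0),
            (0,0,1), (1,0,1), (2,0,1), (2,1,1), (1,1,1), (0,1,1)]"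

lemma corner_simps [simp]:
  "corner (X, Y, j) $ 1 = of_int X" "corner (X, Y, j) $ 2 = of_int Y"
  "corner (X, Y, j) $ 3 = of_int (step_height X Y) / 3 + 2 * of_int j"
  by (simp_all add: corner_def)

lemma set_cells: "set cells = {0..2} \<times> {0..1} \<times> {0..1}"
proof -
  have "{0..2} = {0, 1, 2 :: int}" "{0..1} = {0, 1 :: int}" by auto
  then show ?thesis unfolding cells_def by auto
qed

lemma S_eq: "S = (\<Union>i\<in>set cells. cube (corner i))"
proof -
  have eq: "{q + t | q t. q \<in> cbox 0 1 \<and> t \<in> T} = (\<Union>t\<in>T. cube t)" for T :: "(real ^ 3) set"
  proof -
    have "(\<Union>t\<in>T. cube t) = (\<Union>t\<in>T. (+) t ` cube 0)" by (simp add: translate_cube)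
    also have "\<dots> = {q + t | q t. q \<in> cbox 0 1 \<and> t \<in> T}"
      unfolding cube_def by (auto, metis add.commute)
    finally show ?thesis by simp
  qed
  show ?thesis
    unfolding S_def eq by (simp add: cells_def corner_def step_height_def)
qed

lemma mem_S_iff:
  "p \<in> S \<longleftrightarrow> (\<exists>X Y j. X \<in> {0..2} \<and> Y \<in> {0..1} \<and> j \<in> {0..1} \<and> p \<in> cube (corner (X, Y, j)))"
  unfolding S_eq set_cells by blast

lemma mem_cube_3: "p \<in> cube v \<longleftrightarrow>
    v $ 1 \<le> p $ 1 \<and> p $ 1 \<le> v $ 1 + 1 \<and> v $ 2 \<le> p $ 2 \<and> p $ 2 \<le> v $ 2 + 1 \<and>
    v $ 3 \<le> p $ 3 \<and> p $ 3 \<le> v $ 3 + 1" for p v :: "real ^ 3"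
  by (auto simp: mem_cube forall_3)

section \<open>Connectedness\<close>

lemma connected_Union_successively:
  assumes "\<And>i. connected (C i)" "successively (\<lambda>i j. C i \<inter> C j \<noteq> {}) xs"
  shows "connected (\<Union>i\<in>set xs. C i)"
  using assms(2)
proof (induction xs)
  case (Cons a xs)
  show ?case
  proof (cases xs)
    case (Cons b ys)
    then show ?thesis
      using Cons.IH Cons.prems assms(1) by (auto intro!: connected_Un)
  qed (use assms(1) in simp)
qed simp

lemma connected_S: "connected S"
  unfolding S_eq
proof (rule connected_Union_successively)
  show "connected (cube (corner i))" for i
    unfolding cube_def by (intro convex_connected convex_box)
  show "successively (\<lambda>i j. cube (corner i) \<inter> cube (corner j) \<noteq> {}) cells"
    unfolding cells_def
    by (simp, intro conjI cube_meets_cube) (simp_all add: forall_3 step_height_def)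
qed

section \<open>The tiling by 3Z x 2Z x (4Z + {0,1})\<close>

text \<open>A null set that contains the boundaries of all cells: corners have integral first two
  coordinates, and heights in Z/3.\<close>

definition faces :: "(real ^ 3) set" where
  "faces = {p. p $ 1 \<in> \<int> \<or> p $ 2 \<in> \<int> \<or> 3 * p $ 3 \<in> \<int>}"

lemma negligible_hyperplane_cart: "negligible {p :: real ^ 'n. p $ i = c}"
  using negligible_standard_hyperplane[of "axis i 1 :: real ^ 'n" c] by (simp add: inner_axis axis_in_Basis_iff)

lemma faces_null: "faces \<in> null_sets lebesgue"
proof -
  have "faces \<subseteq> (\<Union>k::int. {p. p $ 1 = of_int k} \<union> {p. p $ 2 = of_int k} \<union> {p. p $ 3 = of_int k / 3})"
    by (auto simp: faces_def field_simps elim!: Ints_cases)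
  moreover have "(\<Union>k::int. {p :: real ^ 3. p $ 1 = of_int k} \<union> {p. p $ 2 = of_int k} \<union> {p. p $ 3 = of_int k / 3})
      \<in> null_sets lebesgue"
    by (intro null_sets_UN null_sets.Un)
      (simp_all only: negligible_hyperplane_cart flip: negligible_iff_null_sets)
  ultimately show ?thesis
    using negligible_subset unfolding negligible_iff_null_sets[symmetric] by blast
qed

text \<open>The upper faces of a cell lie in \<open>faces\<close>, so off that set the closed cell
  behaves like a half-open one and floors recover its index. In particular such a point lies in at
  most one cell.\<close>

lemma floor_off_faces:
  assumes "p \<in> cube (corner (X, Y, j))" "p \<notin> faces"
  shows "\<lfloor>p $ 1\<rfloor> = X" "\<lfloor>p $ 2\<rfloor> = Y" "\<lfloor>p $ 3 - of_int (step_height X Y) / 3\<rfloor> = 2 * j"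
proof -
  have int: "p $ 1 \<notin> \<int>" "p $ 2 \<notin> \<int>" "3 * p $ 3 \<notin> \<int>"
    using assms(2) by (simp_all add: faces_def)
  have "p $ 1 \<noteq> of_int (X + 1)" using int(1) Ints_of_int by metis
  moreover have "p $ 2 \<noteq> of_int (Y + 1)" using int(2) Ints_of_int by metis
  moreover have "3 * p $ 3 \<noteq> of_int (step_height X Y + 6 * j + 3)" using int(3) Ints_of_int by metis
  ultimately show "\<lfloor>p $ 1\<rfloor> = X" "\<lfloor>p $ 2\<rfloor> = Y" "\<lfloor>p $ 3 - of_int (step_height X Y) / 3\<rfloor> = 2 * j"
    using assms(1) by (auto simp: mem_cube_3 floor_eq_iff)
qed

text \<open>Reduction of the first two coordinates modulo 3 and 2 picks a column of
  \<open>S\<close>. Over its base height that column occupies the unit intervals at 0 and 2, and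
  their translates by 4Z + {0,1} fill the line once.\<close>

lemma tiles_S:
  "tiles_by S {vector [3 * of_int a, 2 * of_int b, 4 * of_int c + r] | (a::int) (b::int) (c::int) (r::real).
     r \<in> {0, 1}}" (is "tiles_by S ?T")
proof -
  have cover: "p \<in> (\<Union>t\<in>?T. (+) t ` S)" for p
  proof -
    define X Y where "X = \<lfloor>p $ 1\<rfloor> mod 3" and "Y = \<lfloor>p $ 2\<rfloor> mod 2"
    define m where "m = \<lfloor>p $ 3 - of_int (step_height X Y) / 3\<rfloor>"
    \<comment> \<open>Here \<open>m = 4 * (m div 4) + 2 * j + r\<close>; the digit \<open>j\<close>
      selects the turn of the staircase and \<open>r\<close> the vertical translation.\<close>
    define j r where "j = (m mod 4) div 2" and "r = m mod 2"
    define t :: "real ^ 3" where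
      "t = vector [3 * of_int (\<lfloor>p $ 1\<rfloor> div 3), 2 * of_int (\<lfloor>p $ 2\<rfloor> div 2), 4 * of_int (m div 4) + of_int r]"
    have X: "\<lfloor>p $ 1\<rfloor> = 3 * (\<lfloor>p $ 1\<rfloor> div 3) + X" "X \<in> {0..2}"
      using pos_mod_bound[of 3 "\<lfloor>p $ 1\<rfloor>"] by (auto simp: X_def)
    have Y: "\<lfloor>p $ 2\<rfloor> = 2 * (\<lfloor>p $ 2\<rfloor> div 2) + Y" "Y \<in> {0..1}"
      by (auto simp: Y_def)
    have j: "m = 4 * (m div 4) + r + 2 * j" "j \<in> {0..1}" and r: "r = 0 \<or> r = 1"
      unfolding j_def r_def by auto presburger+
    have "of_int \<lfloor>p $ 1\<rfloor> \<le> p $ 1 \<and> p $ 1 \<le> of_int \<lfloor>p $ 1\<rfloor> + 1"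
      "of_int \<lfloor>p $ 2\<rfloor> \<le> p $ 2 \<and> p $ 2 \<le> of_int \<lfloor>p $ 2\<rfloor> + 1"
      "of_int m \<le> p $ 3 - of_int (step_height X Y) / 3 \<and> p $ 3 - of_int (step_height X Y) / 3 \<le> of_int m + 1"
      unfolding m_def by linarith+
    moreover have "real_of_int \<lfloor>p $ 1\<rfloor> = 3 * of_int (\<lfloor>p $ 1\<rfloor> div 3) + of_int X"
      "real_of_int \<lfloor>p $ 2\<rfloor> = 2 * of_int (\<lfloor>p $ 2\<rfloor> div 2) + of_int Y"
      "real_of_int m = 4 * of_int (m div 4) + of_int r + 2 * of_int j"
      using arg_cong[OF X(1), of real_of_int] arg_cong[OF Y(1), of real_of_int] arg_cong[OF j(1), of real_of_int]
      unfolding of_int_add of_int_mult of_int_numeral .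
    ultimately have "p - t \<in> cube (corner (X, Y, j))"
      unfolding mem_cube_3 t_def by simp
    then have "p - t \<in> S" using X Y j mem_S_iff by blast
    moreover have "t \<in> ?T" using r unfolding t_def by fastforce
    ultimately show ?thesis
      by (intro UN_I[of t]) (auto intro!: image_eqI[of _ _ "p - t"])
  qed
  have disjoint: "((+) t ` S) \<inter> ((+) t' ` S) \<subseteq> faces" if tt: "t \<in> ?T" "t' \<in> ?T" "t \<noteq> t'" for t t'
  proof (rule ccontr)
    assume "\<not> ?thesis"
    then obtain p where "p \<in> (+) t ` S" "p \<in> (+) t' ` S" and "p \<notin> faces" by blast
    then have p: "p - t \<in> S" "p - t' \<in> S" "p \<notin> faces" by (metis add_diff_cancel_left' imageE)+
    \<comment> \<open>Off the faces, the floors of \<open>p\<close> express the column, the turn and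
      the translation together; below, uniqueness of division with remainder separates them.\<close>
    have off: "\<exists>X Y j. X \<in> {0..2} \<and> Y \<in> {0..1} \<and> j \<in> {0..1} \<and> \<lfloor>p $ 1\<rfloor> = 3 * a + X \<and> \<lfloor>p $ 2\<rfloor> = 2 * b + Y \<and>
        \<lfloor>p $ 3 - of_int (step_height X Y) / 3\<rfloor> = 4 * c + r + 2 * j"
      if t: "t = vector [3 * of_int a, 2 * of_int b, 4 * of_int c + of_int r]" and "p - t \<in> S" for t a b c r
    proof -
      obtain X Y j where *: "X \<in> {0..2}" "Y \<in> {0..1}" "j \<in> {0..1}" "p - t \<in> cube (corner (X, Y, j))"
        using \<open>p - t \<in> S\<close> mem_S_iff by blast
      \<comment> \<open>All coordinates of \<open>t\<close> are integers, so \<open>p - t\<close>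
        stays off the faces.\<close>
      have "(p - t) $ 1 \<in> \<int> \<Longrightarrow> p $ 1 \<in> \<int>"
        using Ints_add[of "(p - t) $ 1" "of_int (3 * a)"] by (simp add: t)
      moreover have "(p - t) $ 2 \<in> \<int> \<Longrightarrow> p $ 2 \<in> \<int>"
        using Ints_add[of "(p - t) $ 2" "of_int (2 * b)"] by (simp add: t)
      moreover have "3 * (p - t) $ 3 \<in> \<int> \<Longrightarrow> 3 * p $ 3 \<in> \<int>"
        using Ints_add[of "3 * (p - t) $ 3" "of_int (12 * c + 3 * r)"] by (simp add: t algebra_simps)
      ultimately have "p - t \<notin> faces"
        using p(3) unfolding faces_def mem_Collect_eq by blast
      note fl = floor_off_faces[OF *(4) this]
      have "\<lfloor>p $ 1\<rfloor> = 3 * a + X" "\<lfloor>p $ 2\<rfloor> = 2 * b + Y"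
        "\<lfloor>p $ 3 - of_int (step_height X Y) / 3\<rfloor> = 4 * c + r + 2 * j"
        using fl by (simp_all add: t floor_eq_iff)
      then show ?thesis using * by blast
    qed
    have param: "\<exists>a b c r. t = vector [3 * of_int a, 2 * of_int b, 4 * of_int c + of_int r] \<and> (r = 0 \<or> r = (1 :: int))"
      if "t \<in> ?T" for t
    proof -
      obtain a b c and r :: real where t: "t = vector [3 * of_int a, 2 * of_int b, 4 * of_int c + r]" and "r \<in> {0, 1}"
        using \<open>t \<in> ?T\<close> by blast
      then obtain r' :: int where "r = of_int r'" "r' = 0 \<or> r' = 1"
        by (cases "r = 0") force+
      then show ?thesis using t by blast
    qed
    obtain a b c r where t: "t = vector [3 * of_int a, 2 * of_int b, 4 * of_int c + of_int r]" and r: "r = 0 \<or> r = 1"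
      using param[OF tt(1)] by blast
    obtain a' b' c' r' where t': "t' = vector [3 * of_int a', 2 * of_int b', 4 * of_int c' + of_int r']"
        and r': "r' = 0 \<or> r' = 1"
      using param[OF tt(2)] by blast
    obtain X Y j where X: "X \<in> {0..2}" "Y \<in> {0..1}" "j \<in> {0..1}" "\<lfloor>p $ 1\<rfloor> = 3 * a + X" "\<lfloor>p $ 2\<rfloor> = 2 * b + Y"
        "\<lfloor>p $ 3 - of_int (step_height X Y) / 3\<rfloor> = 4 * c + r + 2 * j"
      using off[OF t p(1)] by blast
    obtain X' Y' j' where X': "X' \<in> {0..2}" "Y' \<in> {0..1}" "j' \<in> {0..1}" "\<lfloor>p $ 1\<rfloor> = 3 * a' + X'" "\<lfloor>p $ 2\<rfloor> = 2 * b' + Y'"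
        "\<lfloor>p $ 3 - of_int (step_height X' Y') / 3\<rfloor> = 4 * c' + r' + 2 * j'"
      using off[OF t' p(2)] by blast
    have "3 * a + X = 3 * a' + X'" "2 * b + Y = 2 * b' + Y'" using X X' by auto
    then have ab: "a = a'" "X = X'" "b = b'" "Y = Y'"
      using X(1,2) X'(1,2) by (auto; presburger)+
    \<comment> \<open>The columns agree, so both heights are measured from the same base.\<close>
    then have "4 * c + r + 2 * j = 4 * c' + r' + 2 * j'" using X(6) X'(6) by simp
    then have "c = c'" "r = r'"
      using X(3) X'(3) r r' by (auto; presburger)+
    then show False using t t' ab tt(3) by simp
  qed
  have "- (\<Union>t\<in>?T. (+) t ` S) = {}" using cover by blast
  then have "- (\<Union>t\<in>?T. (+) t ` S) \<in> null_sets lebesgue" by (simp only: null_sets.empty_sets)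
  moreover have "((+) t ` S) \<inter> ((+) t' ` S) \<in> null_sets lebesgue" if "t \<in> ?T" "t' \<in> ?T" "t \<noteq> t'" for t t'
    using negligible_subset[OF _ disjoint[OF that]] faces_null unfolding negligible_iff_null_sets .
  ultimately show ?thesis
    unfolding tiles_by_def by blast
qed

section \<open>No tiling by a group of translations\<close>

lemma nonoverlap_cubes:
  assumes "tiles_by S L" "t \<in> L" "t' \<in> L" "i \<in> set cells" "i' \<in> set cells"
    and "\<forall>k. \<bar>(t + corner i) $ k - (t' + corner i') $ k\<bar> < 1"
  shows "t = t'"
proof (rule ccontr)
  assume "t \<noteq> t'"
  then have "((+) t ` S) \<inter> ((+) t' ` S) \<in> null_sets lebesgue"
    using assms(1-3) by (auto simp: tiles_by_def)
  moreover have "cube (t + corner i) \<inter> cube (t' + corner i') \<subseteq> ((+) t ` S) \<inter> ((+) t' ` S)"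
    using assms(4,5) by (auto simp: S_eq simp flip: translate_cube)
  ultimately show False
    using cube_overlap_not_null[OF assms(6)] by blast
qed

lemma cubes_meet_box:
  assumes "tiles_by S L" "\<forall>k. a $ k < b $ k"
  obtains p t i where "p \<in> box a b" "t \<in> L" "i \<in> set cells" "p \<in> cube (t + corner i)"
proof -
  have "- (\<Union>t\<in>L. (+) t ` S) \<in> null_sets lebesgue" using assms(1) by (simp add: tiles_by_def)
  then have "\<not> box a b \<subseteq> - (\<Union>t\<in>L. (+) t ` S)" using box_not_null[OF assms(2)] by blast
  then obtain p t where "p \<in> box a b" "t \<in> L" "p \<in> (+) t ` S" by auto
  then show ?thesis
    using that by (auto simp: S_eq image_UN translate_cube)
qed

text \<open>The box \<open>[1, 2] \<times> [0, 1] \<times> [4/3, 7/3]\<close> is a gap of \<open>S\<close> that is open only in the direction of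
  negative \<open>y\<close>: cells of \<open>S\<close> lie below, above and behind it, and partly on its two sides.\<close>

lemma cube_in_gap:
  assumes L: "tiles_by S L" "0 \<in> L" and t: "t \<in> L" "i \<in> set cells"
    and p: "p \<in> box (vector [1, 0, 4/3]) (vector [2, 1, 7/3])" "p \<in> cube (t + corner i)"
  shows "(t + corner i) $ 1 = 1" "(t + corner i) $ 3 = 4/3" "(t + corner i) $ 2 \<le> 0"
proof -
  define q where "q = t + corner i"
  have q: "\<bar>q $ 1 - 1\<bar> < 1" "\<bar>q $ 2\<bar> < 1" "\<bar>q $ 3 - 4/3\<bar> < 1"
    using p unfolding q_def[symmetric] by (auto simp: mem_box_cart mem_cube_3 forall_3 abs_less_iff)
  have "t \<noteq> 0"
  proof
    assume "t = 0"
    then show False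
      using q t(2) unfolding q_def cells_def by (auto simp: step_height_def abs_less_iff)
  qed
  then have no: "\<not> (\<bar>q $ 1 - corner i' $ 1\<bar> < 1 \<and> \<bar>q $ 2 - corner i' $ 2\<bar> < 1 \<and> \<bar>q $ 3 - corner i' $ 3\<bar> < 1)"
    if "i' \<in> set cells" for i'
    using nonoverlap_cubes[OF L(1) t(1) L(2) t(2) that] unfolding q_def forall_3 by auto
  \<comment> \<open>The cells of \<open>S\<close> below and above the gap end at height 4/3 and
    begin at 7/3, so a unit cube that enters the gap has height exactly 4/3.\<close>
  have below: "\<bar>q $ 3 - 1/3\<bar> \<ge> 1" and above: "\<bar>q $ 3 - 7/3\<bar> \<ge> 1"
    using no[of "(1,0,0)"] no[of "(1,0,1)"] q by (auto simp: cells_def step_height_def)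
  then have q3: "q $ 3 = 4/3" using q by (auto simp: abs_le_iff abs_less_iff abs_if split: if_splits)
  \<comment> \<open>The cell behind the gap also has height 4/3.\<close>
  have "\<bar>q $ 2 - 1\<bar> \<ge> 1"
    using no[of "(1,1,0)"] q q3 by (auto simp: cells_def step_height_def)
  then have q2: "q $ 2 \<le> 0" using q by (auto simp: abs_if split: if_splits)
  \<comment> \<open>The lateral neighbours have heights 2 and 2/3. Each covers a part of the side
    only, but both overlap a cube of height 4/3 vertically.\<close>
  have "\<bar>q $ 1\<bar> \<ge> 1" "\<bar>q $ 1 - 2\<bar> \<ge> 1"
    using no[of "(0,0,1)"] no[of "(2,0,0)"] q q3 by (auto simp: cells_def step_height_def)
  then have q1: "q $ 1 = 1" using q by (auto simp: abs_if split: if_splits)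
  show "(t + corner i) $ 1 = 1" "(t + corner i) $ 3 = 4/3" "(t + corner i) $ 2 \<le> 0"
    using q1 q2 q3 by (auto simp: q_def)
qed

text \<open>If a cell entered the gap without filling it, a second one would have to cover the rest.
  Their y-coordinates would differ by less than 1, so both would belong to one translate; but cells
  of one translate differ by integers there.\<close>

lemma gap_filled_by_cube:
  assumes L: "tiles_by S L" "0 \<in> L"
  obtains t i where "t \<in> L" "i \<in> set cells" "t + corner i = vector [1, 0, 4/3]"
proof -
  obtain p t i where p: "p \<in> box (vector [1, 0, 4/3]) (vector [2, 1, 7/3])" and t: "t \<in> L" "i \<in> set cells"
      and "p \<in> cube (t + corner i)"
    by (rule cubes_meet_box[OF L(1), of "vector [1, 0, 4/3]" "vector [2, 1, 7/3]"]) (auto simp: forall_3)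
  note q = cube_in_gap[OF L t p this(4)]
  have "(t + corner i) $ 2 = 0"
  proof (rule ccontr)
    assume "(t + corner i) $ 2 \<noteq> 0"
    then have neg: "(t + corner i) $ 2 < 0" using q by simp
    \<comment> \<open>The part of the gap with second coordinate above \<open>y\<close> lies beyond
      the first cell.\<close>
    define y where "y = max 0 ((t + corner i) $ 2 + 1)"
    have y: "0 \<le> y" "y < 1" "(t + corner i) $ 2 + 1 \<le> y" using neg by (auto simp: y_def)
    obtain p' t' i' where p': "p' \<in> box (vector [1, y, 4/3]) (vector [2, 1, 7/3])" and t': "t' \<in> L" "i' \<in> set cells"
        and p't': "p' \<in> cube (t' + corner i')"
      by (rule cubes_meet_box[OF L(1), of "vector [1, y, 4/3]" "vector [2, 1, 7/3]"]) (use y in \<open>auto simp: forall_3\<close>)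
    have "p' \<in> box (vector [1, 0, 4/3]) (vector [2, 1, 7/3])"
      using p' y by (auto simp: mem_box_cart forall_3)
    note q' = cube_in_gap[OF L t' this p't']
    have less: "(t + corner i) $ 2 < (t' + corner i') $ 2"
      using p' p't' y by (auto simp: mem_box_cart forall_3 mem_cube_3)
    have "p $ 2 > 0" "p $ 2 \<le> (t + corner i) $ 2 + 1"
      using p \<open>p \<in> cube (t + corner i)\<close> by (auto simp: mem_box_cart forall_3 mem_cube_3)
    then have less1: "(t' + corner i') $ 2 < (t + corner i) $ 2 + 1" using q' by linarith
    have "t = t'"
    proof (rule nonoverlap_cubes[OF L(1) t(1) t'(1) t(2) t'(2)], rule allI)
      fix k :: 3
      show "\<bar>(t + corner i) $ k - (t' + corner i') $ k\<bar> < 1"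
        using q q' less less1 exhaust_3[of k] by (auto simp: abs_less_iff)
    qed
    then have "corner i $ 2 < corner i' $ 2" "corner i' $ 2 < corner i $ 2 + 1"
      using less less1 by auto
    then show False by (cases i; cases i') auto
  qed
  then have "t + corner i = vector [1, 0, 4/3]"
    using q by (simp add: vec_eq_iff forall_3)
  then show ?thesis using t that by blast
qed

lemma not_tiles_S_subgroup:
  assumes "int_module.subspace L"
  shows "\<not> tiles_by S L"
proof
  assume L: "tiles_by S L"
  have 0: "0 \<in> L" using assms by (rule int_module.subspace_0)
  obtain t i where t: "t \<in> L" "i \<in> set cells" "t + corner i = vector [1, 0, 4/3]"
    using gap_filled_by_cube[OF L 0] by blast
  have t_eq: "t = vector [1, 0, 4/3] - corner i" using t(3) by (metis add_diff_cancel_right')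
  \<comment> \<open>If the gap is filled by a cell of the column (1, 0), then \<open>t\<close> is
    (0, 0, 1) or (0, 0, -1), and \<open>S\<close> and \<open>t + S\<close> do not overlap. The
    double of \<open>t\<close> moves one turn of the staircase onto the other.\<close>
  have "of_int 2 *\<^sub>R t \<in> L" using int_module.subspace_scale[OF assms t(1)] .
  then have t2: "2 *\<^sub>R t \<in> L" by simp
  have overlap: "s = 0" if "s \<in> L" "a \<in> set cells" "b \<in> set cells"
      "\<bar>s $ 1 + corner a $ 1 - corner b $ 1\<bar> < 1" "\<bar>s $ 2 + corner a $ 2 - corner b $ 2\<bar> < 1"
      "\<bar>s $ 3 + corner a $ 3 - corner b $ 3\<bar> < 1" for s a b
    using nonoverlap_cubes[OF L that(1) 0 that(2,3)] that(4-6) unfolding forall_3 by simp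
  \<comment> \<open>\<open>(i, n, a, b)\<close>: if the cell \<open>i\<close> of \<open>t + S\<close> fills the gap, then the cell \<open>a\<close> of \<open>n t + S\<close>
    overlaps the cell \<open>b\<close> of \<open>S\<close>.\<close>
  define table :: "((int \<times> int \<times> int) \<times> real \<times> (int \<times> int \<times> int) \<times> (int \<times> int \<times> int)) set" where
    "table = {((0,0,0), 1, (0,1,0), (1,1,1)), ((1,0,0), 2, (0,0,0), (0,0,1)),
              ((2,0,0), 1, (1,1,0), (0,1,0)), ((2,1,0), 1, (1,1,0), (0,0,1)),
              ((1,1,0), 1, (0,1,0), (0,0,1)), ((0,1,0), 1, (1,1,0), (2,0,0)),
              ((0,0,1), 1, (1,1,1), (2,1,1)), ((1,0,1), 2, (0,0,1), (0,0,0)),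
              ((2,0,1), 1, (1,1,1), (0,1,0)), ((2,1,1), 1, (1,1,1), (0,0,1)),
              ((1,1,1), 1, (0,1,1), (0,0,1)), ((0,1,1), 1, (1,1,1), (2,0,0))}"
  obtain n a b where n: "(i, n, a, b) \<in> table"
    using t(2) unfolding cells_def table_def by auto
  have "n *\<^sub>R t = 0"
  proof (rule overlap)
    have "n = 1 \<or> n = 2" using n by (auto simp: table_def)
    then show "n *\<^sub>R t \<in> L" using t(1) t2 by auto
    show "a \<in> set cells" "b \<in> set cells" using n by (auto simp: table_def cells_def)
    show "\<bar>(n *\<^sub>R t) $ 1 + corner a $ 1 - corner b $ 1\<bar> < 1"
      "\<bar>(n *\<^sub>R t) $ 2 + corner a $ 2 - corner b $ 2\<bar> < 1"
      "\<bar>(n *\<^sub>R t) $ 3 + corner a $ 3 - corner b $ 3\<bar> < 1"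
      using n by (auto simp: table_def t_eq step_height_def)
  qed
  moreover have "n \<noteq> 0" using n by (auto simp: table_def)
  ultimately have "t = 0" by simp
  \<comment> \<open>The gap would be a cell of \<open>S\<close> itself, but the cells in its column
    have heights 1/3 and 7/3.\<close>
  then have "corner i = vector [1, 0, 4/3]" using t(3) by simp
  then have "corner i $ 1 = 1" "corner i $ 2 = 0" "corner i $ 3 = 4/3" by simp_all
  then show False
    using t(2) by (auto simp: cells_def step_height_def)
qed

section \<open>Orthogonality\<close>

definition unit_exp :: "real \<Rightarrow> complex" where
  "unit_exp t = exp (2 * complex_of_real pi * \<i> * complex_of_real t)"

lemma exponential_eq: "exponential l x = unit_exp (l \<bullet> x)"
  by (simp add: exponential_def unit_exp_def)

lemma unit_exp_0 [simp]: "unit_exp 0 = 1"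
  by (simp add: unit_exp_def)

lemma unit_exp_add: "unit_exp (s + t) = unit_exp s * unit_exp t"
  by (simp add: unit_exp_def distrib_left exp_add)

lemma unit_exp_eq_cis: "unit_exp t = cis (2 * pi * t)"
  by (simp add: unit_exp_def cis_conv_exp mult_ac)

lemma norm_unit_exp [simp]: "norm (unit_exp t) = 1"
  by (simp add: unit_exp_eq_cis)

lemma cnj_unit_exp: "cnj (unit_exp t) = unit_exp (- t)"
  by (simp add: unit_exp_eq_cis cis_cnj)

lemma unit_exp_eq_1_iff: "unit_exp t = 1 \<longleftrightarrow> t \<in> \<int>"
proof -
  have "unit_exp t = 1 \<longleftrightarrow> (\<exists>n::int. t = of_int n)"
    by (auto simp: unit_exp_def exp_eq_1)
  then show ?thesis by (auto elim: Ints_cases)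
qed

lemma unit_exp_half: "unit_exp (1/2) = -1"
  by (simp add: unit_exp_eq_cis)

lemma unit_exp_add_Ints: "k \<in> \<int> \<Longrightarrow> unit_exp (t + k) = unit_exp t"
  by (simp add: unit_exp_add unit_exp_eq_1_iff)

lemma continuous_on_unit_exp [continuous_intros]:
  "continuous_on A f \<Longrightarrow> continuous_on A (\<lambda>x. unit_exp (f x))"
  unfolding unit_exp_def by (intro continuous_intros)

lemma borel_measurable_unit_exp [measurable]: "unit_exp \<in> borel_measurable borel"
  by (intro borel_measurable_continuous_onI continuous_intros)

lemma borel_measurable_exponential [measurable]: "exponential l \<in> borel_measurable borel"
  unfolding exponential_eq[abs_def] by measurable

lemma inner_3: "x \<bullet> y = x $ 1 * y $ 1 + x $ 2 * y $ 2 + x $ 3 * y $ 3" for x y :: "real ^ 3"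
  by (simp add: inner_vec_def sum_3)

lemma borel_translation: "A \<in> sets borel \<Longrightarrow> (+) t ` A \<in> sets borel"
  for A :: "'a::real_normed_vector set"
proof -
  assume A: "A \<in> sets borel"
  have "(+) t ` A = (\<lambda>x. x - t) -` A"
    by (force simp: image_iff)
  then show ?thesis
    using measurable_sets[of "\<lambda>x. x - t" borel borel A] A
    by (simp add: borel_measurable_continuous_onI continuous_intros)
qed

section \<open>Integrals of exponentials over the unit cube\<close>

lemma set_integral_exponential_translate:
  fixes l :: "real ^ 'n"
  assumes "A \<in> sets borel"
  shows "(LINT x:(+) t ` A|lborel. exponential l x) = exponential l t * (LINT x:A|lborel. exponential l x)"
proof -
  have m: "(\<lambda>x. indicator ((+) t ` A) x *\<^sub>R exponential l x) \<in> borel_measurable borel"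
    using borel_translation[OF assms] by measurable
  have "(LINT x:(+) t ` A|lborel. exponential l x)
      = (LINT x|distr lborel borel ((+) t). indicator ((+) t ` A) x *\<^sub>R exponential l x)"
    by (simp add: set_lebesgue_integral_def lborel_distr_plus)
  also have "\<dots> = (LINT x|lborel. indicator ((+) t ` A) (t + x) *\<^sub>R exponential l (t + x))"
    by (rule integral_distr) (use m in auto)
  also have "\<dots> = (LINT x|lborel. exponential l t * (indicator A x *\<^sub>R exponential l x))"
    by (intro Bochner_Integration.integral_cong)
      (auto simp: exponential_eq inner_add_right unit_exp_add indicator_def)
  finally show ?thesis
    by (simp only: set_lebesgue_integral_def integral_mult_right_zero)
qed

lemma set_integrable_exponential:
  assumes "A \<in> sets borel" "bounded A"
  shows "set_integrable lborel A (exponential l)"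
  unfolding set_integrable_def
  by (rule integrableI_bounded_set_indicator[where B = 1])
    (use assms emeasure_bounded_finite[OF assms(2)] in \<open>auto simp: exponential_eq\<close>)

text \<open>Half-open, so that cutting and reassembling the cube gives disjoint unions without
  exceptional null sets.\<close>

definition half_open_cube :: "real ^ 'n \<Rightarrow> (real ^ 'n) set" where
  "half_open_cube v = {p. \<forall>i. v $ i \<le> p $ i \<and> p $ i < v $ i + 1}"

lemma half_open_cube_subset: "half_open_cube v \<subseteq> cube v"
  by (auto simp: half_open_cube_def mem_cube less_imp_le)

lemma half_open_cube_borel [measurable]: "half_open_cube v \<in> sets borel"
  unfolding half_open_cube_def by measurable

lemma bounded_half_open_cube: "bounded (half_open_cube v)"
  using half_open_cube_subset bounded_cbox bounded_subset unfolding cube_def by blast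

lemma translate_half_open_cube: "(+) t ` half_open_cube v = half_open_cube (t + v)"
proof -
  have "p \<in> (+) t ` half_open_cube v" if "p \<in> half_open_cube (t + v)" for p
  proof (rule image_eqI[of _ _ "p - t"])
    show "p - t \<in> half_open_cube v"
      using that by (auto simp: half_open_cube_def algebra_simps)
  qed simp
  then show ?thesis
    by (auto simp: half_open_cube_def algebra_simps)
qed

text \<open>Translating the unit cube by half a wavelength in direction \<open>i\<close> changes the sign of the integral;
  but, as the exponential has period 1 in that direction, it also preserves the integral.\<close>

lemma integral_exponential_half_open_cube:
  fixes l :: "real ^ 'n"
  assumes "l $ i \<in> \<int>" "l $ i \<noteq> 0"
  shows "(LINT x:half_open_cube 0|lborel. exponential l x) = 0"
proof -
  let ?I = "\<lambda>A. LINT x:A|lborel. exponential l x"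
  \<comment> \<open>Half a wavelength: \<open>l $ i * h\<close> is 1/2 or -1/2. Since
    \<open>l $ i\<close> is a nonzero integer, \<open>h\<close> is at most 1.\<close>
  define h where "h = 1 / (2 * \<bar>l $ i\<bar>)"
  have "1 \<le> \<bar>l $ i\<bar>" using assms by (auto elim!: Ints_cases)
  then have h: "0 < h" "h \<le> 1" using assms by (auto simp: h_def field_simps)
  define A1 A2 where "A1 = {p \<in> half_open_cube 0. p $ i < h}"
    and "A2 = {p \<in> half_open_cube (0 :: real ^ 'n). h \<le> p $ i}"
  have ax: "axis i c $ j = (if j = i then c else 0)" for c :: real and j by (simp add: axis_def)
  have A[measurable]: "A1 \<in> sets borel" "A2 \<in> sets borel"
    unfolding A1_def A2_def by measurable
  have b: "bounded A1" "bounded A2" "bounded ((+) (axis i 1) ` A1)"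
    by (intro bounded_translation bounded_subset[OF bounded_half_open_cube[of 0]]; force simp: A1_def A2_def)+
  have split: "half_open_cube 0 = A1 \<union> A2" "A1 \<inter> A2 = {}"
    by (auto simp: A1_def A2_def)
  \<comment> \<open>The shift by \<open>h\<close> amounts to cutting off the slab \<open>A1\<close>
    below \<open>h\<close> and putting it back one unit further along direction
    \<open>i\<close>.\<close>
  have "p \<in> half_open_cube (axis i h) \<longleftrightarrow> p \<in> A2 \<or> p - axis i 1 \<in> A1" for p
  proof -
    have "p \<in> half_open_cube (axis i h) \<longleftrightarrow> h \<le> p $ i \<and> p $ i < h + 1 \<and> (\<forall>j. j \<noteq> i \<longrightarrow> 0 \<le> p $ j \<and> p $ j < 1)"
      by (auto simp: half_open_cube_def ax)
    moreover have "p \<in> A2 \<longleftrightarrow> h \<le> p $ i \<and> p $ i < 1 \<and> (\<forall>j. j \<noteq> i \<longrightarrow> 0 \<le> p $ j \<and> p $ j < 1)"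
      using h by (auto simp: half_open_cube_def A2_def) (metis order.trans less_imp_le)+
    moreover have "p - axis i 1 \<in> A1 \<longleftrightarrow> 1 \<le> p $ i \<and> p $ i < h + 1 \<and> (\<forall>j. j \<noteq> i \<longrightarrow> 0 \<le> p $ j \<and> p $ j < 1)"
      using h by (auto simp: half_open_cube_def A1_def ax)
    ultimately show ?thesis using h by auto
  qed
  then have shifted: "half_open_cube (axis i h) = A2 \<union> (+) (axis i 1) ` A1"
    by (force simp: image_iff algebra_simps)
  have "p $ i < 1" if "p \<in> A2" for p using that by (simp add: A2_def half_open_cube_def)
  moreover have "1 \<le> p $ i" if "p \<in> (+) (axis i 1) ` A1" for p
    using that by (auto simp: A1_def half_open_cube_def ax)
  ultimately have disj: "A2 \<inter> (+) (axis i 1) ` A1 = {}" by fastforce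
  have "?I (half_open_cube (axis i h)) = ?I A2 + ?I ((+) (axis i 1) ` A1)"
    unfolding shifted
    by (intro set_integral_Un disj set_integrable_exponential b A borel_translation)
  also have "\<dots> = ?I A2 + ?I A1"
  proof -
    have "exponential l (axis i 1) = 1"
      using assms(1) by (simp add: exponential_eq inner_axis unit_exp_eq_1_iff)
    then show ?thesis by (simp add: set_integral_exponential_translate A)
  qed
  also have "\<dots> = ?I (half_open_cube 0)"
    unfolding split(1) by (subst set_integral_Un) (auto intro: set_integrable_exponential A b simp: split(2))
  finally have "?I (half_open_cube (axis i h)) = ?I (half_open_cube 0)" .
  moreover have "?I (half_open_cube (axis i h)) = exponential l (axis i h) * ?I (half_open_cube 0)"
    using set_integral_exponential_translate[OF half_open_cube_borel[of 0], of "axis i h" l]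
    by (simp add: translate_half_open_cube)
  moreover have "exponential l (axis i h) = -1"
  proof -
    have "l $ i * h = 1/2 \<or> l $ i * h = 1/2 + (-1)"
      using assms(2) by (auto simp: h_def field_simps abs_if)
    then have "unit_exp (l $ i * h) = -1"
      by (elim disjE) (simp_all only: unit_exp_half unit_exp_add_Ints Ints_minus Ints_1)
    then show ?thesis by (simp add: exponential_eq inner_axis)
  qed
  ultimately show ?thesis by simp
qed

section \<open>Integrals of exponentials over the staircase\<close>

lemma AE_indicator_S:
  "AE x in lborel. indicator S x = (\<Sum>i\<in>set cells. indicator (half_open_cube (corner i)) x :: real)"
proof -
  have "AE x in lebesgue. x \<notin> faces" using faces_null by (rule AE_not_in)
  then have "AE x in lborel. x \<notin> faces" by (simp add: AE_completion_iff)
  then show ?thesis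
  proof eventually_elim
    case (elim x)
    have half_open: "x \<in> half_open_cube (corner i) \<longleftrightarrow> x \<in> cube (corner i)" for i
    proof
      assume c: "x \<in> cube (corner i)"
      obtain X Y j where i: "i = (X, Y, j)" by (cases i)
      show "x \<in> half_open_cube (corner i)"
        using c floor_off_faces[of x X Y j] elim unfolding i
        by (auto simp: half_open_cube_def forall_3 mem_cube_3 floor_eq_iff)
    qed (use half_open_cube_subset in blast)
    have unique: "i = i'" if "x \<in> cube (corner i)" "x \<in> cube (corner i')" for i i'
    proof -
      obtain X Y j X' Y' j' where i: "i = (X, Y, j)" "i' = (X', Y', j')" by (cases i; cases i')
      show ?thesis
        using floor_off_faces[of x X Y j] floor_off_faces[of x X' Y' j'] that elim i by simp
    qed
    show ?case
    proof (cases "x \<in> S")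
      case True
      then obtain i where i: "i \<in> set cells" "x \<in> cube (corner i)" by (auto simp: S_eq)
      have "(\<Sum>i'\<in>set cells. indicator (half_open_cube (corner i')) x :: real) = (\<Sum>i'\<in>set cells. if i' = i then 1 else 0)"
      proof (intro sum.cong refl)
        fix i'
        have "x \<in> half_open_cube (corner i') \<longleftrightarrow> i' = i" using half_open unique i(2) by blast
        then show "indicator (half_open_cube (corner i')) x = (if i' = i then 1 else 0 :: real)"
          by (simp add: indicator_def)
      qed
      then show ?thesis using i True by simp
    next
      case False
      then have "x \<notin> cube (corner i)" if "i \<in> set cells" for i using that by (auto simp: S_eq)
      then show ?thesis using False by (simp add: indicator_def half_open)
    qed
  qed
qed

lemma compact_S: "compact S"
  unfolding S_eq cube_def by (intro compact_UN) auto

lemma S_lmeasurable: "S \<in> lmeasurable"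
  by (rule lmeasurable_compact[OF compact_S])

lemma S_lebesgue [measurable, simp]: "S \<in> sets lebesgue"
  using S_lmeasurable by (rule fmeasurableD)

lemma integral_exponential_S:
  "(LINT x|lebesgue_on S. exponential l x)
    = (\<Sum>i\<in>set cells. exponential l (corner i)) * (LINT x:half_open_cube 0|lborel. exponential l x)"
proof -
  have S: "S \<in> sets borel" using compact_S by (simp add: borel_compact)
  have meas: "(\<lambda>x. indicator S x *\<^sub>R exponential l x) \<in> borel_measurable borel"
    using S by measurable
  have meas': "(\<lambda>x. \<Sum>i\<in>set cells. indicator (half_open_cube (corner i)) x *\<^sub>R exponential l x) \<in> borel_measurable borel"
    by measurable
  have int: "set_integrable lborel (half_open_cube v) (exponential l)" for v
    by (intro set_integrable_exponential bounded_half_open_cube) simp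
  have "(LINT x|lebesgue_on S. exponential l x) = (LINT x|lebesgue. indicator S x *\<^sub>R exponential l x)"
    by (rule integral_restrict_space) simp
  also have "\<dots> = (LINT x|lborel. indicator S x *\<^sub>R exponential l x)"
    by (rule integral_completion) (use meas in simp)
  also have "\<dots> = (LINT x|lborel. (\<Sum>i\<in>set cells. indicator (half_open_cube (corner i)) x *\<^sub>R exponential l x))"
  proof (rule integral_cong_AE)
    show "AE x in lborel. indicator S x *\<^sub>R exponential l x
        = (\<Sum>i\<in>set cells. indicator (half_open_cube (corner i)) x *\<^sub>R exponential l x)"
      using AE_indicator_S by eventually_elim (simp flip: scaleR_sum_left)
  qed (use meas meas' in \<open>simp_all only: measurable_lborel2\<close>)
  also have "\<dots> = (\<Sum>i\<in>set cells. LINT x:half_open_cube (corner i)|lborel. exponential l x)"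
    unfolding set_lebesgue_integral_def using int
    by (intro Bochner_Integration.integral_sum) (simp add: set_integrable_def)
  also have "\<dots> = (\<Sum>i\<in>set cells. exponential l (corner i) * (LINT x:half_open_cube 0|lborel. exponential l x))"
    using set_integral_exponential_translate[OF half_open_cube_borel[of 0], of "corner _" l]
    by (simp add: translate_half_open_cube)
  finally show ?thesis by (simp add: sum_distrib_right)
qed

lemma sum_cells:
  "(\<Sum>i\<in>set cells. f i) = (\<Sum>X\<in>{0..2}. \<Sum>Y\<in>{0..1}. f (X, Y, 0) + f (X, Y, 1))"
proof -
  have "{0..1} = {0, 1 :: int}" by auto
  then show ?thesis
    unfolding set_cells sum.cartesian_product' by simp
qed

text \<open>If \<open>s\<close> is not 0, the two turns cancel. If \<open>s = 0\<close> and
  \<open>c = 0\<close>, heights do not affect the exponential, and the corner sum is a product of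
  two sums over roots of unity; one vanishes unless \<open>a / 3\<close> and \<open>b / 2\<close>
  are integers. In all other cases \<open>l\<close> has a nonzero integral coordinate and the
  integral over the unit cube vanishes.\<close>

lemma integral_exponential_S_eq_0:
  fixes a b c :: int
  assumes l: "l = vector [of_int a / 3, of_int b / 2, of_int c + s]" "l \<noteq> 0" and s: "s \<in> {0, 1/4, -1/4}"
  shows "(LINT x|lebesgue_on S. exponential l x) = 0"
proof (cases "s = 0")
  case False
  \<comment> \<open>One turn raises a cell by 2, which changes the phase by \<open>2 * s\<close>
    modulo integers, that is by a half.\<close>
  have "exponential l (corner (X, Y, 1)) = - exponential l (corner (X, Y, 0))" for X Y
  proof -
    have "l \<bullet> corner (X, Y, 1) = (l \<bullet> corner (X, Y, 0) + 2 * s) + of_int (2 * c)"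
      by (simp add: inner_3 l(1) algebra_simps)
    then have "exponential l (corner (X, Y, 1)) = unit_exp (l \<bullet> corner (X, Y, 0) + 2 * s)"
      by (simp only: exponential_eq unit_exp_add_Ints Ints_of_int)
    then have "exponential l (corner (X, Y, 1)) = exponential l (corner (X, Y, 0)) * unit_exp (2 * s)"
      by (simp only: exponential_eq unit_exp_add)
    moreover have "2 * s = 1/2 \<or> 2 * s = 1/2 + (-1)" using s False by auto
    then have "unit_exp (2 * s) = -1"
      by (elim disjE) (simp_all only: unit_exp_half unit_exp_add_Ints Ints_minus Ints_1)
    ultimately show ?thesis by simp
  qed
  then show ?thesis
    by (simp add: integral_exponential_S sum_cells)
next
  case True
  show ?thesis
  proof (cases "c = 0 \<and> \<not> (of_int a / 3 \<in> (\<int> :: real set) \<and> of_int b / 2 \<in> (\<int> :: real set))")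
    case True
    have e: "exponential l (corner (X, Y, j)) = unit_exp (of_int a / 3 * of_int X) * unit_exp (of_int b / 2 * of_int Y)" for X Y j
      using True \<open>s = 0\<close> by (simp add: exponential_eq inner_3 l(1) unit_exp_add)
    have "(\<Sum>i\<in>set cells. exponential l (corner i))
        = 2 * ((\<Sum>X\<in>{0..2}. unit_exp (of_int a / 3 * of_int X)) * (\<Sum>Y\<in>{0..1}. unit_exp (of_int b / 2 * of_int Y)))"
      unfolding sum_product by (simp only: sum_cells e mult_2[symmetric] sum_distrib_left)
    moreover have "(\<Sum>X\<in>{0..2::int}. unit_exp (of_int a / 3 * of_int X)) = 0" if "of_int a / 3 \<notin> (\<int> :: real set)"
    proof -
      define w where "w = unit_exp (of_int a / 3)"
      have "w \<noteq> 1" using that by (simp add: w_def unit_exp_eq_1_iff)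
      have w2: "unit_exp (of_int a / 3 * 2) = w * w"
        unfolding w_def by (simp add: mult.commute flip: unit_exp_add)
      have "w * w * w = unit_exp (of_int a)"
        unfolding w_def by (simp flip: unit_exp_add)
      also have "\<dots> = 1" by (simp add: unit_exp_eq_1_iff)
      \<comment> \<open>\<open>w\<close> is a cube root of unity different from 1.\<close>
      finally have "(w - 1) * (1 + w + w * w) = 0" by (simp add: algebra_simps)
      then have "1 + w + w * w = 0" using \<open>w \<noteq> 1\<close> by simp
      moreover have "{0..2} = {0, 1, 2 :: int}" by auto
      ultimately show ?thesis using w2 by (simp add: w_def add.assoc)
    qed
    moreover have "(\<Sum>Y\<in>{0..1::int}. unit_exp (of_int b / 2 * of_int Y)) = 0" if "of_int b / 2 \<notin> (\<int> :: real set)"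
    proof -
      define w where "w = unit_exp (of_int b / 2)"
      have "w \<noteq> 1" using that by (simp add: w_def unit_exp_eq_1_iff)
      have "w * w = unit_exp (of_int b)"
        unfolding w_def by (simp flip: unit_exp_add)
      also have "\<dots> = 1" by (simp add: unit_exp_eq_1_iff)
      finally have "(w - 1) * (1 + w) = 0" by (simp add: algebra_simps)
      then have "1 + w = 0" using \<open>w \<noteq> 1\<close> by simp
      moreover have "{0..1} = {0, 1 :: int}" by auto
      ultimately show ?thesis by (simp add: w_def)
    qed
    ultimately show ?thesis using True by (auto simp: integral_exponential_S)
  next
    case no: False
    have "\<exists>i. l $ i \<in> \<int> \<and> l $ i \<noteq> 0"
    proof (cases "c = 0")
      case True
      have "l $ 1 \<in> \<int>" "l $ 2 \<in> \<int>" "l $ 3 = 0" using no True \<open>s = 0\<close> by (auto simp: l(1))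
      then show ?thesis using \<open>l \<noteq> 0\<close> by (auto simp: vec_eq_iff forall_3)
    next
      case False
      then have "l $ 3 \<in> \<int> \<and> l $ 3 \<noteq> 0" using \<open>s = 0\<close> by (simp add: l(1))
      then show ?thesis by blast
    qed
    then show ?thesis
      using integral_exponential_half_open_cube by (auto simp: integral_exponential_S)
  qed
qed

section \<open>Completeness\<close>

definition staircase_spectrum :: "(real ^ 3) set" where
  "staircase_spectrum = {vector [of_int a / 3, of_int b / 2, of_int c + r] | (a::int) (b::int) (c::int) (r::real).
     r \<in> {0, 1/4}}"

definition trig_polys :: "(real ^ 3 \<Rightarrow> complex) set" where
  "trig_polys = {\<lambda>x. \<Sum>l\<in>F. c l * exponential l x | F c. finite F \<and> F \<subseteq> staircase_spectrum}"

lemma trig_polysI: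
  "finite F \<Longrightarrow> F \<subseteq> staircase_spectrum \<Longrightarrow> (\<lambda>x. \<Sum>l\<in>F. c l * exponential l x) \<in> trig_polys"
  unfolding trig_polys_def by blast

lemma trig_polysE:
  assumes "g \<in> trig_polys"
  obtains F c where "finite F" "F \<subseteq> staircase_spectrum" "g = (\<lambda>x. \<Sum>l\<in>F. c l * exponential l x)"
  using assms unfolding trig_polys_def by blast

lemma finite_measure_S: "finite_measure (lebesgue_on S)"
  by (rule finite_measure_lebesgue_on[OF S_lmeasurable])

lemma measurable_lebesgue_on_S:
  "f \<in> borel_measurable borel \<Longrightarrow> f \<in> borel_measurable (lebesgue_on S)" for f :: "real ^ 3 \<Rightarrow> 'b::topological_space"
  by (intro measurable_restrict_space1 measurable_completion) simp

lemma norm_exponential [simp]: "cmod (exponential l x) = 1"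
  by (simp add: exponential_eq)

lemma exponential_add_left: "exponential (l + m) x = exponential l x * exponential m x"
  by (simp add: exponential_eq inner_add_left unit_exp_add)

lemma square_integrable_bounded_S:
  assumes "f \<in> borel_measurable borel" "\<And>x. cmod (f x) \<le> B"
  shows "square_integrable (lebesgue_on S) f"
proof -
  interpret finite_measure "lebesgue_on S" by (rule finite_measure_S)
  have m: "f \<in> borel_measurable (lebesgue_on S)" using assms(1) by (rule measurable_lebesgue_on_S)
  have "integrable (lebesgue_on S) (\<lambda>x. (cmod (f x))\<^sup>2)"
  proof (rule integrable_const_bound[of _ "B\<^sup>2"])
    show "AE x in lebesgue_on S. norm ((cmod (f x))\<^sup>2) \<le> B\<^sup>2"
      using power_mono[OF assms(2) norm_ge_zero, of _ 2] by simp
  qed (use m in measurable)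
  then show ?thesis using m unfolding square_integrable_def by blast
qed

lemma L2_subspace_trig_polys: "L2_subspace (lebesgue_on S) trig_polys"
proof -
  interpret finite_measure "lebesgue_on S" by (rule finite_measure_S)
  show ?thesis
  proof
    fix g assume "g \<in> trig_polys"
    then obtain F c where F: "finite F" "F \<subseteq> staircase_spectrum" and g: "g = (\<lambda>x. \<Sum>l\<in>F. c l * exponential l x)"
      by (rule trig_polysE)
    have "cmod (g x) \<le> (\<Sum>l\<in>F. cmod (c l))" for x
      unfolding g by (rule sum_norm_le) (simp add: norm_mult)
    moreover have "g \<in> borel_measurable borel"
      unfolding g by measurable
    ultimately show "square_integrable (lebesgue_on S) g"
      by (intro square_integrable_bounded_S)
  next
    show "(\<lambda>x. 0) \<in> trig_polys" using trig_polysI[of "{}"] by simp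
  next
    fix f g assume f: "f \<in> trig_polys" and g: "g \<in> trig_polys"
    obtain F c where F1: "finite F" "F \<subseteq> staircase_spectrum" and fF: "f = (\<lambda>x. \<Sum>l\<in>F. c l * exponential l x)"
      using f by (rule trig_polysE)
    obtain F' c' where F2: "finite F'" "F' \<subseteq> staircase_spectrum" and gF: "g = (\<lambda>x. \<Sum>l\<in>F'. c' l * exponential l x)"
      using g by (rule trig_polysE)
    note F = F1 F2 and fg = fF gF
    \<comment> \<open>Both coefficient families are extended by 0 to the union of the frequency
      sets.\<close>
    have "(\<lambda>x. f x + g x)
        = (\<lambda>x. \<Sum>l\<in>F \<union> F'. ((if l \<in> F then c l else 0) + (if l \<in> F' then c' l else 0)) * exponential l x)"
    proof
      fix x
      have "f x = (\<Sum>l\<in>F \<union> F'. (if l \<in> F then c l else 0) * exponential l x)"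
        unfolding fg by (rule sum.mono_neutral_cong_left) (use F in auto)
      moreover have "g x = (\<Sum>l\<in>F \<union> F'. (if l \<in> F' then c' l else 0) * exponential l x)"
        unfolding fg by (rule sum.mono_neutral_cong_left) (use F in auto)
      ultimately show "f x + g x
          = (\<Sum>l\<in>F \<union> F'. ((if l \<in> F then c l else 0) + (if l \<in> F' then c' l else 0)) * exponential l x)"
        by (simp only: distrib_right sum.distrib)
    qed
    then show "(\<lambda>x. f x + g x) \<in> trig_polys"
      using F trig_polysI[of "F \<union> F'"] by simp
  next
    fix f c assume "f \<in> trig_polys"
    then obtain F d where F: "finite F" "F \<subseteq> staircase_spectrum" and f: "f = (\<lambda>x. \<Sum>l\<in>F. d l * exponential l x)"
      by (rule trig_polysE)
    show "(\<lambda>x. c * f x) \<in> trig_polys"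
      using trig_polysI[OF F, of "\<lambda>l. c * d l"] by (simp add: f sum_distrib_left mult.assoc)
  qed
qed

interpretation S_L2: L2_subspace "lebesgue_on S" trig_polys
  by (rule L2_subspace_trig_polys)

lemma exponential_in_L2_closure: "l \<in> staircase_spectrum \<Longrightarrow> exponential l \<in> S_L2.L2_closure"
  using trig_polysI[of "{l}" "\<lambda>_. 1"] S_L2.E_subset_L2_closure by auto

text \<open>Multiplication by an exponential shifts frequencies, so by linearity it is enough to
  treat the exponentials of the spectrum.\<close>

lemma exponential_multiplierI:
  assumes "\<And>m. m \<in> staircase_spectrum \<Longrightarrow> exponential (l + m) \<in> S_L2.L2_closure"
  shows "S_L2.multiplier (exponential l)"
proof (rule S_L2.multiplierI[where B = 1])
  show "exponential l \<in> borel_measurable (lebesgue_on S)"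
    by (intro measurable_lebesgue_on_S borel_measurable_exponential)
  fix g assume "g \<in> trig_polys"
  then obtain F d where F: "finite F" "F \<subseteq> staircase_spectrum" and g: "g = (\<lambda>x. \<Sum>l\<in>F. d l * exponential l x)"
    by (rule trig_polysE)
  have "(\<lambda>x. \<Sum>m\<in>F. d m * exponential (l + m) x) \<in> S_L2.L2_closure"
    using F by (intro S_L2.L2_closure_sum S_L2.L2_closure_scale assms) auto
  then show "(\<lambda>x. exponential l x * g x) \<in> S_L2.L2_closure"
    by (simp add: g sum_distrib_left exponential_add_left mult_ac)
qed auto

section \<open>Measurability of the coordinates\<close>

text \<open>Translation by such an \<open>l\<close> maps the spectrum into itself, and so does
  translation by \<open>- l\<close>, the frequency of the conjugate.\<close>

lemma exponential_periods_measurable_multiplier_measure: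
  fixes a b c :: int
  assumes l: "l = vector [of_int a / 3, of_int b / 2, of_int c]"
  shows "exponential l \<in> borel_measurable S_L2.multiplier_measure"
proof (rule S_L2.multiplier_cnj_imp_measurable_multiplier_measure)
  have *: "S_L2.multiplier (exponential l)" if "l = vector [of_int a / 3, of_int b / 2, of_int c]"
    for l and a b c :: int
  proof (rule exponential_multiplierI, rule exponential_in_L2_closure)
    fix m assume "m \<in> staircase_spectrum"
    then obtain a' b' c' and r :: real where r: "r \<in> {0, 1/4}"
        and "m = vector [of_int a' / 3, of_int b' / 2, of_int c' + r]"
      unfolding staircase_spectrum_def by blast
    then have "l + m = vector [of_int (a + a') / 3, of_int (b + b') / 2, of_int (c + c') + r]"
      by (simp add: that vec_eq_iff forall_3 field_simps)
    then show "l + m \<in> staircase_spectrum"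
      using r unfolding staircase_spectrum_def by blast
  qed
  show "S_L2.multiplier (exponential l)" by (rule *[OF l])
  have "(\<lambda>x. cnj (exponential l x)) = exponential (- l)"
    by (simp add: fun_eq_iff exponential_eq cnj_unit_exp)
  moreover have "- l = vector [of_int (-a) / 3, of_int (-b) / 2, of_int (-c)]"
    by (simp add: l vec_eq_iff forall_3)
  ultimately show "S_L2.multiplier (\<lambda>x. cnj (exponential l x))"
    using *[of "- l" "- a" "- b" "- c"] by simp
qed

lemma borel_measurable_Arg2pi [measurable]: "Arg2pi \<in> borel_measurable borel"
  by (rule borel_measurableI_greater) (use open_Arg2pi2pi_gt in simp)

text \<open>Fractional parts are Borel functions of the exponential, so their measurability follows
  from that of the exponentials.\<close>

lemma frac_eq_Arg2pi: "frac t = Arg2pi (unit_exp t) / (2 * pi)"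
proof -
  have "unit_exp t = unit_exp (frac t)"
    using unit_exp_add_Ints[of "of_int \<lfloor>t\<rfloor>" "frac t"] by (simp add: frac_def)
  also have "\<dots> = exp (\<i> * of_real (2 * pi * frac t))"
    by (simp add: unit_exp_def mult_ac)
  also have "Arg2pi \<dots> = 2 * pi * frac t"
    using Arg2pi_exp[of "\<i> * of_real (2 * pi * frac t)"] frac_lt_1[of t] by simp
  finally show ?thesis by simp
qed

lemma AE_S_off_faces: "AE p in lebesgue_on S. p \<in> S \<and> p \<notin> faces"
proof -
  have "AE p in lebesgue. p \<notin> faces" using faces_null by (rule AE_not_in)
  then show ?thesis by (auto simp: AE_restrict_space_iff elim: eventually_mono)
qed

lemma coordinates_1_2_measurable_multiplier_measure:
  "(\<lambda>p. p $ 1) \<in> borel_measurable S_L2.multiplier_measure" "(\<lambda>p. p $ 2) \<in> borel_measurable S_L2.multiplier_measure"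
  "(\<lambda>p. frac (p $ 3)) \<in> borel_measurable S_L2.multiplier_measure"
proof -
  have frac: "(\<lambda>p. frac (l \<bullet> p)) \<in> borel_measurable S_L2.multiplier_measure"
    if "l = vector [of_int a / 3, of_int b / 2, of_int c]" for l and a b c :: int
  proof -
    note [measurable] = exponential_periods_measurable_multiplier_measure[OF that]
    have "(\<lambda>p. Arg2pi (exponential l p) / (2 * pi)) \<in> borel_measurable S_L2.multiplier_measure" by measurable
    then show ?thesis by (simp add: exponential_eq frac_eq_Arg2pi)
  qed
  have 1: "(\<lambda>p. frac (p $ 1 / 3)) \<in> borel_measurable S_L2.multiplier_measure"
    using frac[of "vector [1/3, 0, 0]" 1 0 0] by (simp add: inner_3)
  have 2: "(\<lambda>p. frac (p $ 2 / 2)) \<in> borel_measurable S_L2.multiplier_measure"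
    using frac[of "vector [0, 1/2, 0]" 0 1 0] by (simp add: inner_3)
  show "(\<lambda>p. frac (p $ 3)) \<in> borel_measurable S_L2.multiplier_measure"
    using frac[of "vector [0, 0, 1]" 0 0 1] by (simp add: inner_3)
  \<comment> \<open>On \<open>S\<close> off the faces, \<open>p $ 1 / 3\<close> and
    \<open>p $ 2 / 2\<close> lie in [0, 1) and equal their fractional parts.\<close>
  have coords: "p $ 1 = 3 * frac (p $ 1 / 3) \<and> p $ 2 = 2 * frac (p $ 2 / 2)" if p: "p \<in> S" "p \<notin> faces" for p
  proof -
    obtain X Y j where i: "X \<in> {0..2}" "Y \<in> {0..1}" "p \<in> cube (corner (X, Y, j))"
      using p(1) mem_S_iff by blast
    have "\<lfloor>p $ 1\<rfloor> = X" "\<lfloor>p $ 2\<rfloor> = Y" using floor_off_faces[OF i(3) p(2)] by auto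
    then have "0 \<le> p $ 1" "p $ 1 < 3" "0 \<le> p $ 2" "p $ 2 < 2"
      using i(1,2) by (auto simp: floor_eq_iff)
    then have "frac (p $ 1 / 3) = p $ 1 / 3" "frac (p $ 2 / 2) = p $ 2 / 2"
      by (simp_all add: frac_eq)
    then show ?thesis by simp
  qed
  show "(\<lambda>p. p $ 1) \<in> borel_measurable S_L2.multiplier_measure"
  proof (rule S_L2.measurable_multiplier_measure_cong_AE)
    show "(\<lambda>p. 3 * frac (p $ 1 / 3)) \<in> borel_measurable S_L2.multiplier_measure" using 1 by measurable
    show "AE p in lebesgue_on S. 3 * frac (p $ 1 / 3) = p $ 1"
      using AE_S_off_faces by eventually_elim (metis coords)
  qed (intro measurable_lebesgue_on_S, measurable)
  show "(\<lambda>p. p $ 2) \<in> borel_measurable S_L2.multiplier_measure"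
  proof (rule S_L2.measurable_multiplier_measure_cong_AE)
    show "(\<lambda>p. 2 * frac (p $ 2 / 2)) \<in> borel_measurable S_L2.multiplier_measure" using 2 by measurable
    show "AE p in lebesgue_on S. 2 * frac (p $ 2 / 2) = p $ 2"
      using AE_S_off_faces by eventually_elim (metis coords)
  qed (intro measurable_lebesgue_on_S, measurable)
qed

text \<open>The two cubes of \<open>S\<close> above one another in a column differ by the translation \<open>(0, 0, 2)\<close>;
  \<open>lower_height p\<close> is the height of the representative of \<open>p\<close> in the lower one.\<close>

definition lower_height :: "real ^ 3 \<Rightarrow> real" where
  "lower_height p = (let h = (if \<lfloor>p $ 2\<rfloor> = 0 then of_int \<lfloor>p $ 1\<rfloor> else 5 - of_int \<lfloor>p $ 1\<rfloor>) / 3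
     in h + frac (frac (p $ 3) - h))"

lemma lower_height_measurable_multiplier_measure: "lower_height \<in> borel_measurable S_L2.multiplier_measure"
proof -
  note [measurable] = coordinates_1_2_measurable_multiplier_measure
  show ?thesis unfolding lower_height_def[abs_def] Let_def frac_def[of "_ - _"] by measurable
qed

lemma lower_height_S:
  assumes "p \<in> S" "p \<notin> faces"
  shows "p $ 3 - lower_height p \<in> {0, 2}"
proof -
  obtain X Y j where i: "X \<in> {0..2}" "Y \<in> {0..1}" "j \<in> {0..1}" "p \<in> cube (corner (X, Y, j))"
    using assms(1) mem_S_iff by blast
  define h where "h = real_of_int (step_height X Y) / 3"
  have fl: "\<lfloor>p $ 1\<rfloor> = X" "\<lfloor>p $ 2\<rfloor> = Y" "\<lfloor>p $ 3 - h\<rfloor> = 2 * j"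
    using floor_off_faces[OF i(4) assms(2)] by (auto simp: h_def)
  \<comment> \<open>Replacing \<open>p $ 3\<close> by its fractional part changes it by an integer,
    which the outer \<open>frac\<close> removes. What remains is the height within the cell.\<close>
  have "frac (frac (p $ 3) - h) = frac ((p $ 3 - h) + of_int (- \<lfloor>p $ 3\<rfloor>))"
    by (simp add: frac_def[of "p $ 3"] algebra_simps)
  also have "\<dots> = frac (p $ 3 - h)"
    unfolding frac_def floor_add_int[symmetric] by (simp add: algebra_simps)
  also have "\<dots> = p $ 3 - h - 2 * of_int j" using fl by (simp add: frac_def)
  finally have "h + frac (frac (p $ 3) - h) = p $ 3 - 2 * of_int j" by simp
  moreover have "(if \<lfloor>p $ 2\<rfloor> = 0 then of_int \<lfloor>p $ 1\<rfloor> else 5 - of_int \<lfloor>p $ 1\<rfloor>) / 3 = h"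
    using fl(1,2) by (simp add: h_def step_height_def)
  ultimately have "lower_height p = p $ 3 - 2 * of_int j"
    by (simp only: lower_height_def Let_def)
  moreover have "j = 0 \<or> j = 1" using i(3) by auto
  ultimately show ?thesis by auto
qed

text \<open>\<open>p $ 3\<close> and \<open>lower_height p\<close> differ by 0 or 2, hence their
  multiples by \<open>k\<close> differ by an integer and the exponentials agree.\<close>

lemma unit_exp_height_half_multiplier:
  assumes "k \<in> {1/2, -1/2}"
  shows "S_L2.multiplier (\<lambda>p. unit_exp (k * p $ 3))"
proof (rule S_L2.multiplier_cong_AE[where B = 1])
  note [measurable] = lower_height_measurable_multiplier_measure
  show "S_L2.multiplier (\<lambda>p. unit_exp (k * lower_height p))"
    by (rule S_L2.measurable_multiplier_measure_imp_multiplier[where B = 1]) simp_all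
  show "AE p in lebesgue_on S. unit_exp (k * lower_height p) = unit_exp (k * p $ 3)"
    using AE_S_off_faces
  proof eventually_elim
    case (elim p)
    then have "p $ 3 = lower_height p \<or> p $ 3 = lower_height p + 2" using lower_height_S[of p] by auto
    then have "k * p $ 3 = k * lower_height p \<or> k * p $ 3 = k * lower_height p + 1 \<or> k * p $ 3 = k * lower_height p + (-1)"
      using assms by (auto simp: algebra_simps)
    then show ?case
      by (elim disjE) (simp_all only: unit_exp_add_Ints Ints_minus Ints_1)
  qed
  show "(\<lambda>p. unit_exp (k * p $ 3)) \<in> borel_measurable (lebesgue_on S)"
    by (intro measurable_lebesgue_on_S) measurable
qed simp

text \<open>Adding 1/4 to the last coordinate takes frequencies in Z to Z + 1/4, inside the
  spectrum. It takes Z + 1/4 to Z + 1/2, outside it; there the exponential is that of a frequency of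
  the spectrum times the multiplier with \<open>k = 1/2\<close>.\<close>

lemma unit_exp_height_quarter_multiplier: "S_L2.multiplier (\<lambda>p. unit_exp (p $ 3 / 4))"
proof -
  define l :: "real ^ 3" where "l = vector [0, 0, 1/4]"
  have "S_L2.multiplier (exponential l)"
  proof (rule exponential_multiplierI)
    fix m assume "m \<in> staircase_spectrum"
    then obtain a b c and r :: real where m: "m = vector [of_int a / 3, of_int b / 2, of_int c + r]" and "r \<in> {0, 1/4}"
      unfolding staircase_spectrum_def by blast
    then consider "r = 0" | "r = 1/4" by blast
    then show "exponential (l + m) \<in> S_L2.L2_closure"
    proof cases
      case 1
      then have "l + m = vector [of_int a / 3, of_int b / 2, of_int c + 1/4]"
        by (simp add: l_def m vec_eq_iff forall_3)
      moreover have "(1/4 :: real) \<in> {0, 1/4}" by simp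
      ultimately have "l + m \<in> staircase_spectrum"
        unfolding staircase_spectrum_def by blast
      then show ?thesis by (rule exponential_in_L2_closure)
    next
      case 2
      define m' :: "real ^ 3" where "m' = vector [of_int a / 3, of_int b / 2, of_int c + 0]"
      have "m' \<in> staircase_spectrum" unfolding m'_def staircase_spectrum_def by blast
      then have "(\<lambda>p. unit_exp (1/2 * p $ 3) * exponential m' p) \<in> S_L2.L2_closure"
        by (intro S_L2.multiplierD unit_exp_height_half_multiplier exponential_in_L2_closure) auto
      moreover have "exponential (l + m) = (\<lambda>p. unit_exp (1/2 * p $ 3) * exponential m' p)"
        unfolding fun_eq_iff exponential_eq unit_exp_add[symmetric]
        by (simp add: l_def m 2 m'_def inner_3 algebra_simps)
      ultimately show ?thesis by simp
    qed
  qed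
  moreover have "exponential l = (\<lambda>p. unit_exp (p $ 3 / 4))"
    by (simp add: fun_eq_iff exponential_eq l_def inner_3)
  ultimately show ?thesis by simp
qed

text \<open>The conjugate is a multiplier too, because -1/4 = -1/2 + 1/4.\<close>

lemma unit_exp_height_quarter_measurable_multiplier_measure: "(\<lambda>p. unit_exp (p $ 3 / 4)) \<in> borel_measurable S_L2.multiplier_measure"
proof (rule S_L2.multiplier_cnj_imp_measurable_multiplier_measure[OF unit_exp_height_quarter_multiplier])
  have "S_L2.multiplier (\<lambda>p. unit_exp (-1/2 * p $ 3) * unit_exp (p $ 3 / 4))"
    by (intro S_L2.multiplier_mult unit_exp_height_half_multiplier unit_exp_height_quarter_multiplier) simp
  then show "S_L2.multiplier (\<lambda>p. cnj (unit_exp (p $ 3 / 4)))"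
    by (rule S_L2.multiplier_cong) (simp add: cnj_unit_exp flip: unit_exp_add)
qed

lemma coordinate_3_measurable_multiplier_measure: "(\<lambda>p. p $ 3) \<in> borel_measurable S_L2.multiplier_measure"
proof (rule S_L2.measurable_multiplier_measure_cong_AE)
  note [measurable] = lower_height_measurable_multiplier_measure unit_exp_height_quarter_measurable_multiplier_measure
  \<comment> \<open>The product of exponentials is 1 on lower cells and -1 on upper ones, so
    \<open>1 - Re\<close> supplies the missing 0 or 2.\<close>
  show "(\<lambda>p. lower_height p + 1 - Re (unit_exp (p $ 3 / 4) * unit_exp (- lower_height p / 4))) \<in> borel_measurable S_L2.multiplier_measure"
    by measurable
  show "AE p in lebesgue_on S. lower_height p + 1 - Re (unit_exp (p $ 3 / 4) * unit_exp (- lower_height p / 4)) = p $ 3"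
    using AE_S_off_faces
  proof eventually_elim
    case (elim p)
    have "p $ 3 / 4 + - lower_height p / 4 = (p $ 3 - lower_height p) / 4" by (simp add: field_simps)
    then have "unit_exp (p $ 3 / 4) * unit_exp (- lower_height p / 4) = unit_exp ((p $ 3 - lower_height p) / 4)"
      by (simp only: unit_exp_add[symmetric])
    moreover have "p $ 3 - lower_height p = 0 \<or> p $ 3 - lower_height p = 2" using lower_height_S[of p] elim by auto
    ultimately show ?case using unit_exp_half by auto
  qed
qed (intro measurable_lebesgue_on_S, measurable)

text \<open>Measurable coordinates give all Borel subsets of \<open>S\<close>. A Lebesgue set
  differs from a Borel set by a null set, and such modifications stay in the sigma-algebra.\<close>

lemma sets_multiplier_measure_S: "sets S_L2.multiplier_measure = sets (lebesgue_on S)"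
proof (rule antisym[OF S_L2.sets_multiplier_measure_subset], rule subsetI)
  have "(\<lambda>p. p $ i) \<in> borel_measurable S_L2.multiplier_measure" for i :: 3
    using exhaust_3[of i] coordinates_1_2_measurable_multiplier_measure coordinate_3_measurable_multiplier_measure by auto
  then have id: "(\<lambda>p. p) \<in> borel_measurable S_L2.multiplier_measure"
    by (subst borel_measurable_euclidean_space) (auto simp: Basis_vec_def inner_axis)
  fix A assume "A \<in> sets (lebesgue_on S)"
  then have A: "A \<in> sets lebesgue" "A \<subseteq> S" by (auto simp: sets_restrict_space)
  obtain B Z Z' where B: "A = B \<union> Z" "Z \<subseteq> Z'" "Z' \<in> null_sets lborel" "B \<in> sets lborel"
    using A(1) by (rule sets_completionE)
  show "A \<in> sets S_L2.multiplier_measure"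
  proof (rule S_L2.sets_multiplier_measure_AE)
    have "(\<lambda>p. p) -` B \<inter> space S_L2.multiplier_measure \<in> sets S_L2.multiplier_measure" using id B(4) by (intro measurable_sets) auto
    then show "B \<inter> S \<in> sets S_L2.multiplier_measure" by simp
    have "AE p in lebesgue. p \<notin> Z'" using B(3) by (intro AE_not_in null_sets_completionI)
    then show "AE p in lebesgue_on S. (p \<in> B \<inter> S) = (p \<in> A)"
      using A(2) B(1,2) by (auto simp: AE_restrict_space_iff elim!: eventually_mono)
  qed fact
qed

lemma square_integrable_S_in_closure: "square_integrable (lebesgue_on S) f \<Longrightarrow> f \<in> S_L2.L2_closure"
proof (rule S_L2.L2_closure_eq_if_sets_multiplier_measure[OF sets_multiplier_measure_S])
  have "(0 :: real ^ 3) = vector [of_int 0 / 3, of_int 0 / 2, of_int 0 + 0]"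
    by (simp add: vec_eq_iff forall_3)
  then have "0 \<in> staircase_spectrum" unfolding staircase_spectrum_def by blast
  then have "exponential 0 \<in> S_L2.L2_closure" by (rule exponential_in_L2_closure)
  then show "(\<lambda>x. 1) \<in> S_L2.L2_closure" by (simp add: exponential_eq[abs_def])
qed

section \<open>The orthogonal basis\<close>

lemma measure_S_pos: "measure lebesgue S > 0"
proof -
  have "cube (corner (0, 0, 0)) \<subseteq> S" by (auto simp: S_eq cells_def)
  then have "S \<notin> null_sets lebesgue"
    by (intro cube_overlap_not_null[of "corner (0, 0, 0)" "corner (0, 0, 0)"]) auto
  then have "measure lebesgue S \<noteq> 0"
    using negligible_iff_measure0[OF S_lmeasurable] by (simp add: negligible_iff_null_sets)
  then show ?thesis
    by (simp add: zero_less_measure_iff)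
qed

lemma has_spectrum_S: "has_spectrum S staircase_spectrum"
  unfolding has_spectrum_def orthogonal_basis_L2_def
proof (intro conjI ballI impI allI S_lmeasurable measure_S_pos)
  fix l
  show "square_integrable (lebesgue_on S) (exponential l)"
    by (rule square_integrable_bounded_S[where B = 1]) auto
  show "L2_seminorm (lebesgue_on S) (exponential l) \<noteq> 0"
    using measure_S_pos by (simp add: L2_seminorm_def measure_restrict_space)
next
  fix l m assume lm: "l \<in> staircase_spectrum" "m \<in> staircase_spectrum" "l \<noteq> m"
  obtain a b c and r :: real where l: "l = vector [of_int a / 3, of_int b / 2, of_int c + r]" "r \<in> {0, 1/4}"
    using lm(1) unfolding staircase_spectrum_def by blast
  obtain a' b' c' and r' :: real where m: "m = vector [of_int a' / 3, of_int b' / 2, of_int c' + r']" "r' \<in> {0, 1/4}"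
    using lm(2) unfolding staircase_spectrum_def by blast
  have lm_eq: "l - m = vector [of_int (a - a') / 3, of_int (b - b') / 2, of_int (c - c') + (r - r')]"
    by (simp add: l m vec_eq_iff forall_3 diff_divide_distrib)
  have "r - r' \<in> {0, 1/4, -1/4}" using l(2) m(2) by auto
  then have "(LINT x|lebesgue_on S. exponential (l - m) x) = 0"
    using lm(3) by (intro integral_exponential_S_eq_0[OF lm_eq]) simp
  moreover have "exponential l x * cnj (exponential m x) = exponential (l - m) x" for x
    by (simp add: exponential_eq cnj_unit_exp inner_diff_left flip: unit_exp_add)
  ultimately show "L2_inner (lebesgue_on S) (exponential l) (exponential m) = 0"
    by (simp add: L2_inner_def)
next
  fix f and \<epsilon> :: real
  assume f: "square_integrable (lebesgue_on S) f" and "\<epsilon> > 0"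
  \<comment> \<open>Approximation up to the square of \<epsilon>, since \<open>L2_closure\<close>
    measures squared distances and \<open>L2_seminorm\<close> takes the root.\<close>
  then obtain g where "g \<in> trig_polys" and g: "(LINT x|lebesgue_on S. (cmod (f x - g x))\<^sup>2) < \<epsilon>\<^sup>2"
    using S_L2.L2_closure_approx[OF square_integrable_S_in_closure[OF f], of "\<epsilon>\<^sup>2"] by auto
  then obtain F c where F: "finite F" "F \<subseteq> staircase_spectrum" and g_eq: "g = (\<lambda>x. \<Sum>l\<in>F. c l * exponential l x)"
    by (elim trig_polysE)
  have "L2_seminorm (lebesgue_on S) (\<lambda>x. f x - g x) < \<epsilon>"
    unfolding L2_seminorm_def using g \<open>\<epsilon> > 0\<close> by (intro real_less_lsqrt) auto
  then show "\<exists>F c. finite F \<and> F \<subseteq> staircase_spectrum \<and>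
      L2_seminorm (lebesgue_on S) (\<lambda>x. f x - (\<Sum>l\<in>F. c l * exponential l x)) < \<epsilon>"
    using F unfolding g_eq by blast
qed

theorem proposition4p4:
  shows "connected S
    \<and> has_spectrum S
        {vector [of_int a / 3, of_int b / 2, of_int c + r] | (a::int) (b::int) (c::int) (r::real).
           r \<in> {0, 1/4}}
    \<and> tiles_by S
        {vector [3 * of_int a, 2 * of_int b, 4 * of_int c + r] | (a::int) (b::int) (c::int) (r::real).
           r \<in> {0, 1}}
    \<and> \<not> (\<exists>L. is_lattice L \<and> tiles_by S L)"
  using connected_S has_spectrum_S tiles_S not_tiles_S_subgroup
  unfolding staircase_spectrum_def is_lattice_def by blast

end
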